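(* Consider a desired path $\mathcal P$ and one static obstacle with reactive boundary $\mathcal R$, repulsive boundary $\mathcal Q$, mixed area $\mathcal M$ and composite vector field $\chi_c$, as specified in the context. If $\mathcal C_{\mathcal P}\cap\mathcal R^{\mathrm{in}}=\emptyset$, then there is at least one saddle point of the system $\dot\xi(t)=\chi_c(\xi(t))$ in the mixed area $\mathcal M$.
   Context: Conventions: $\operatorname{dist}$ is Euclidean distance (with $\operatorname{dist}(\cdot,\emptyset)=+\infty$), $\overline{A}$ is the closure of $A$, $E=\begin{bmatrix}0&-1\\1&0\end{bmatrix}$, $\hat v=v/\|v\|$ for $v\neq0$. Desired path: $\phi:\mathbb R^2\to\mathbb R$ is $C^2$, $\mathcal P=\{\xi:\phi(\xi)=0\}$ is a one-dimensional connected submanifold of $\mathbb R^2$ on which $\nabla\phi\neq0$. Obstacle and boundaries: $\mathcal O\subseteq\mathbb R^2$ is a bounded set. $\varphi:\mathbb R^2\to\mathbb R$ is $C^2$ and $c\neq0$ is a constant; $\mathcal R=\{\varphi=0\}$ and $\mathcal Q=\{\varphi=c\}$ are compact connected one-dimensional submanifolds of $\mathbb R^2$ on which $\nabla\varphi\ne0$. $\mathcal R^{\mathrm{in}}$ and $\mathcal R^{\mathrm{ex}}$ are the bounded and unbounded connected components of $\mathbb R^2\setminus\mathcal R$; similarly $\mathcal Q^{\mathrm{in}},\mathcal Q^{\mathrm{ex}}$ for $\mathcal Q$. Assumed: $\mathcal O\subseteq\mathcal Q^{\mathrm{in}}\subseteq\mathcal R^{\mathrm{in}}$, $\operatorname{dist}(\mathcal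 Q,\mathcal R)>0$, $\mathcal P\not\subseteq\overline{\mathcal R^{\mathrm{in}}}$, $\mathcal R^{\mathrm{in}}\cap\mathcal P\neq\emptyset$. The mixed area is $\mathcal M=\mathcal Q^{\mathrm{ex}}\cap\mathcal R^{\mathrm{in}}$. Vector fields: with gains $k_p,k_r>0$, $\chi_{\mathcal P}=E\nabla\phi-k_p\phi\nabla\phi$ and $\chi_{\mathcal R}=E\nabla\varphi-k_r\varphi\nabla\varphi$, with singular sets $\mathcal C_{\mathcal P}=\{\chi_{\mathcal P}=0\}=\{\nabla\phi=0\}$, $\mathcal C_{\mathcal R}=\{\chi_{\mathcal R}=0\}=\{\nabla\varphi=0\}$. Standing assumption: for every $\kappa>0$, $\inf\{|\phi(\xi)|:\operatorname{dist}(\xi,\mathcal P)\ge\kappa\}>0$ and $\inf\{\|\nabla\phi(\xi)\|:\operatorname{dist}(\xi,\mathcal C_{\mathcal P})\ge\kappa\}>0$; and likewise with $(\varphi,\mathcal R,\mathcal C_{\mathcal R})$ in place of $(\phi,\mathcal P,\mathcal C_{\mathcal P})$. Composite vector field: $S,Z:\mathcal M\to(0,1)$ are smooth functions such that the function equal to $0$ on $\overline{\mathcal Q^{\mathrm{in}}}$, $S$ on $\mathcal M$, $1$ on $\overline{\mathcal R^{\mathrm{ex}}}$, and the function equal to $1$ on $\overline{\mathcal Q^{\mathrm{in}}}$, $Z$ on $\mathcal M$, $0$ on $\overline{\mathcal R^{\mathrm{ex}}}$, are both $C^\infty$ on $\mathbb R^2$. On $\mathcal D=\mathbb R^2\setminus(\mathcal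 C_{\mathcal R}\cup\mathcal C_{\mathcal P})$, $\chi_c=\hat\chi_{\mathcal R}$ on $\overline{\mathcal Q^{\mathrm{in}}}\cap\mathcal D$, $\chi_c=S\hat\chi_{\mathcal P}+Z\hat\chi_{\mathcal R}$ on $\mathcal M\cap\mathcal D$, and $\chi_c=\hat\chi_{\mathcal P}$ on $\overline{\mathcal R^{\mathrm{ex}}}\cap\mathcal D$. Convention on equilibria: every equilibrium of the planar system is classified as a node, a focus, a center (each of Poincaré index $+1$) or a (hyperbolic) saddle (Poincaré index $-1$).
   Formalization: The composite field is additionally assumed to be defined on the whole mixed area, i.e. the singular set of the reactive field does not meet the mixed area; without this the claim fails, since such singular points can absorb the index and leave no equilibria. *)

theory Defs
  imports "HOL-Complex_Analysis.Complex_Analysis"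
begin

type_synonym plane = "real^2"

definition grad :: "(plane \<Rightarrow> real) \<Rightarrow> plane \<Rightarrow> plane" where
  "grad f x = (\<chi> i. frechet_derivative f (at x) (axis i 1))"

text \<open>Functions of class \<open>C\<^sup>k\<close> on the whole plane: all partial derivatives up to order \<open>k\<close>
  exist and are continuous.\<close>
primrec Ck :: "nat \<Rightarrow> (plane \<Rightarrow> real) \<Rightarrow> bool" where
  "Ck 0 f \<longleftrightarrow> continuous_on UNIV f"
| "Ck (Suc k) f \<longleftrightarrow> (\<forall>x. f differentiable (at x)) \<and> (\<forall>i. Ck k (\<lambda>x. grad f x $ i))"

definition C_infinity :: "(plane \<Rightarrow> real) \<Rightarrow> bool" where
  "C_infinity f \<longleftrightarrow> (\<forall>k. Ck k f)"

text \<open>Extended-valued, so that the distance to the empty set is \<open>\<infinity>\<close> (the library's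
  \<open>infdist\<close> returns \<open>0\<close> there).\<close>
definition edist_to :: "plane \<Rightarrow> plane set \<Rightarrow> ereal" where
  "edist_to x A = (INF a\<in>A. ereal (dist x a))"

text \<open>The infimum is taken in the extended reals, so it is \<open>\<infinity>\<close> over an empty set of points.\<close>
definition positive_away_from :: "(plane \<Rightarrow> real) \<Rightarrow> plane set \<Rightarrow> bool" where
  "positive_away_from g A \<longleftrightarrow>
     (\<forall>\<kappa>>0. 0 < (INF \<xi>\<in>{\<xi>. ereal \<kappa> \<le> edist_to \<xi> A}. ereal (g \<xi>)))"

definition rot :: "real^2^2" where
  "rot = vector [vector [0, -1], vector [1, 0]]"

definition guiding_field :: "real \<Rightarrow> (plane \<Rightarrow> real) \<Rightarrow> plane \<Rightarrow> plane" where
  "guiding_field k f \<xi> = rot *v grad f \<xi> - (k * f \<xi>) *\<^sub>R grad f \<xi>"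

text \<open>The extension of \<open>s\<close>, given on the mixed area, by the constant \<open>a\<close> on the closed inner set
  \<open>A\<close> and by the constant \<open>b\<close> on the closed outer set \<open>B\<close>.\<close>
definition extend_blend ::
    "plane set \<Rightarrow> plane set \<Rightarrow> real \<Rightarrow> real \<Rightarrow> (plane \<Rightarrow> real) \<Rightarrow> plane \<Rightarrow> real" where
  "extend_blend A B a b s \<xi> = (if \<xi> \<in> A then a else if \<xi> \<in> B then b else s \<xi>)"

text \<open>\<open>sgn v\<close> is the normalised vector \<open>v /\<^sub>R norm v\<close>. The value is meaningful only where
  both \<open>XP\<close> and \<open>XR\<close> are nonzero. In the intended use \<open>A\<close> is the closure of the interior of
  the repulsive boundary, \<open>M\<close> is the mixed area, and the points outside \<open>A \<union> M\<close> are
  exactly the closure of the exterior of the reactive boundary.\<close>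
definition composite_field ::
    "plane set \<Rightarrow> plane set \<Rightarrow> (plane \<Rightarrow> real) \<Rightarrow> (plane \<Rightarrow> real) \<Rightarrow>
     (plane \<Rightarrow> plane) \<Rightarrow> (plane \<Rightarrow> plane) \<Rightarrow> plane \<Rightarrow> plane" where
  "composite_field A M S Z XP XR \<xi> =
     (if \<xi> \<in> A then sgn (XR \<xi>)
      else if \<xi> \<in> M then S \<xi> *\<^sub>R sgn (XP \<xi>) + Z \<xi> *\<^sub>R sgn (XR \<xi>)
      else sgn (XP \<xi>))"

text \<open>\<open>D\<close> is the domain of the vector field \<open>X\<close> (state space of the system).\<close>
definition solution_on ::
    "plane set \<Rightarrow> (plane \<Rightarrow> plane) \<Rightarrow> real set \<Rightarrow> (real \<Rightarrow> plane) \<Rightarrow> bool" where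
  "solution_on D X T x \<longleftrightarrow>
     (\<forall>t\<in>T. x t \<in> D \<and> (x has_vector_derivative X (x t)) (at t within T))"

definition equilibrium :: "plane set \<Rightarrow> (plane \<Rightarrow> plane) \<Rightarrow> plane \<Rightarrow> bool" where
  "equilibrium D X p \<longleftrightarrow> p \<in> D \<and> X p = 0"

text \<open>Node and focus: all nearby trajectories converge to the equilibrium, forwards or
  backwards in time, with a limiting direction (node) or with unbounded polar angle (focus).
  They need not be hyperbolic. Centre: all nearby trajectories are closed orbits
  surrounding the equilibrium.\<close>
definition stable_node :: "plane set \<Rightarrow> (plane \<Rightarrow> plane) \<Rightarrow> plane \<Rightarrow> bool" where
  "stable_node D X p \<longleftrightarrow> equilibrium D X p \<and>
     (\<exists>\<delta>>0. \<forall>x0. 0 < dist x0 p \<and> dist x0 p < \<delta> \<longrightarrow>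
        (\<exists>x u. solution_on D X {0..} x \<and> x 0 = x0 \<and> (x \<longlongrightarrow> p) at_top \<and>
               (\<forall>t\<ge>0. x t \<noteq> p) \<and> ((\<lambda>t. sgn (x t - p)) \<longlongrightarrow> u) at_top))"

definition stable_focus :: "plane set \<Rightarrow> (plane \<Rightarrow> plane) \<Rightarrow> plane \<Rightarrow> bool" where
  "stable_focus D X p \<longleftrightarrow> equilibrium D X p \<and>
     (\<exists>\<delta>>0. \<forall>x0. 0 < dist x0 p \<and> dist x0 p < \<delta> \<longrightarrow>
        (\<exists>x \<theta>. solution_on D X {0..} x \<and> x 0 = x0 \<and> (x \<longlongrightarrow> p) at_top \<and>
               (\<forall>t\<ge>0. x t \<noteq> p) \<and> continuous_on {0..} \<theta> \<and>
               (\<forall>t\<ge>0. x t = p + norm (x t - p) *\<^sub>R vector [cos (\<theta> t), sin (\<theta> t)]) \<and>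
               filterlim (\<lambda>t. \<bar>\<theta> t :: real\<bar>) at_top at_top))"

definition node :: "plane set \<Rightarrow> (plane \<Rightarrow> plane) \<Rightarrow> plane \<Rightarrow> bool" where
  "node D X p \<longleftrightarrow> stable_node D X p \<or> stable_node D (\<lambda>\<xi>. - X \<xi>) p"

definition focus :: "plane set \<Rightarrow> (plane \<Rightarrow> plane) \<Rightarrow> plane \<Rightarrow> bool" where
  "focus D X p \<longleftrightarrow> stable_focus D X p \<or> stable_focus D (\<lambda>\<xi>. - X \<xi>) p"

definition center :: "plane set \<Rightarrow> (plane \<Rightarrow> plane) \<Rightarrow> plane \<Rightarrow> bool" where
  "center D X p \<longleftrightarrow> equilibrium D X p \<and>
     (\<exists>\<delta>>0. \<forall>x0. 0 < dist x0 p \<and> dist x0 p < \<delta> \<longrightarrow>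
        (\<exists>x T. solution_on D X UNIV x \<and> x 0 = x0 \<and> 0 < T \<and> (\<forall>t. x (t + T) = x t) \<and>
               p \<in> inside (range x)))"

definition hyperbolic_saddle :: "plane set \<Rightarrow> (plane \<Rightarrow> plane) \<Rightarrow> plane \<Rightarrow> bool" where
  "hyperbolic_saddle D X p \<longleftrightarrow> equilibrium D X p \<and>
     (\<exists>A. (X has_derivative A) (at p) \<and>
          (\<exists>l<0. \<exists>v. v \<noteq> 0 \<and> A v = l *\<^sub>R v) \<and>
          (\<exists>m>0. \<exists>w. w \<noteq> 0 \<and> A w = m *\<^sub>R w))"

text \<open>The library's winding number lives in the complex plane. The index is that of an isolated
  equilibrium: the winding number about \<open>0\<close> of \<open>X\<close> along all small positively oriented
  circles around \<open>p\<close>.\<close>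
definition poincare_index :: "plane set \<Rightarrow> (plane \<Rightarrow> plane) \<Rightarrow> plane \<Rightarrow> int \<Rightarrow> bool" where
  "poincare_index D X p n \<longleftrightarrow>
     (\<exists>\<epsilon>>0. ball p \<epsilon> \<subseteq> D \<and> continuous_on (ball p \<epsilon>) X \<and> (\<forall>\<xi>\<in>ball p \<epsilon> - {p}. X \<xi> \<noteq> 0) \<and>
        (\<forall>r. 0 < r \<and> r < \<epsilon> \<longrightarrow>
           winding_number
             (\<lambda>t. let v = X (p + r *\<^sub>R vector [cos (2 * pi * t), sin (2 * pi * t)])
                  in Complex (v $ 1) (v $ 2)) 0 = of_int n))"

definition classified_equilibrium :: "plane set \<Rightarrow> (plane \<Rightarrow> plane) \<Rightarrow> plane \<Rightarrow> bool" where
  "classified_equilibrium D X p \<longleftrightarrow>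
     (node D X p \<or> focus D X p \<or> center D X p) \<and> poincare_index D X p 1 \<or>
     hyperbolic_saddle D X p \<and> poincare_index D X p (- 1)"

end

theory Submission
  imports Defs
begin

text \<open>Suppose that every zero of the composite field in the mixed area has index one.
  On the repulsive boundary the field is a rotation of the normal direction, so it has index one
  there and extends to the inner region with a single zero of index one. Dividing by the linear
  factors of the zeros, now at least one, leaves a nonvanishing field on the simply connected
  region inside the reactive boundary. Such a field has a continuous logarithm, and so has the
  composite field near the reactive boundary, where it is dominated by the path-following field.
  Hence the product of the linear factors has a continuous logarithm near the boundary, although
  its winding number there is positive.

  Index statements are phrased throughout as existence of continuous logarithms, which needs
  no parametrisation of the boundary curves.\<close>

section \<open>Continuous logarithms\<close>

text \<open>Inside the repulsive boundary the composite field cannot be used directly: it is the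
  normalised reactive field there, which breaks down at the unknown critical points of the level
  function. Only its values on the boundary curve enter, and they fix the index of any continuation.
  The artificial zero placed inside guarantees at least one linear factor, even before any
  equilibrium in the mixed area is known to exist.

  The absence of singular points of the path field inside the reactive boundary makes its
  normalisation zero-free on a simply connected region, hence of total index zero. The inner zero
  contributes one, so only an equilibrium of index minus one, a saddle, can compensate.

  Two classical facts are reached by detours, since the boundaries are known only as level sets.
  That the normal has index one, usually Hopf's theorem on turning tangents, comes from contracting
  the enclosed region. That linear factors cannot have a logarithm near the boundary comes from the
  Riemann map, which replaces the boundary by a circle.\<close>

definition has_log :: "complex set \<Rightarrow> (complex \<Rightarrow> complex) \<Rightarrow> bool" where
  "has_log S f \<longleftrightarrow> (\<exists>g. continuous_on S g \<and> (\<forall>z\<in>S. f z = exp (g z)))"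

section \<open>Algebra of continuous logarithms\<close>

lemma has_log_cong: "has_log S f" if "has_log S g" "\<And>z. z \<in> S \<Longrightarrow> f z = g z"
  using that by (simp add: has_log_def)

lemma has_log_subset: "has_log S f \<Longrightarrow> T \<subseteq> S \<Longrightarrow> has_log T f"
  unfolding has_log_def using continuous_on_subset by blast

lemma has_logI: "continuous_on S g \<Longrightarrow> (\<And>z. z \<in> S \<Longrightarrow> f z = exp (g z)) \<Longrightarrow> has_log S f"
  unfolding has_log_def by blast

lemma has_logE:
  assumes "has_log S f"
  obtains g where "continuous_on S g" "\<And>z. z \<in> S \<Longrightarrow> f z = exp (g z)"
  using assms unfolding has_log_def by blast

lemma has_log_nonzero: "has_log S f \<Longrightarrow> z \<in> S \<Longrightarrow> f z \<noteq> 0"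
  unfolding has_log_def by auto

lemma has_log_mult:
  assumes "has_log S f" "has_log S g"
  shows "has_log S (\<lambda>z. f z * g z)"
proof -
  obtain u v where "continuous_on S u" "\<And>z. z \<in> S \<Longrightarrow> f z = exp (u z)"
    and "continuous_on S v" "\<And>z. z \<in> S \<Longrightarrow> g z = exp (v z)"
    using assms by (auto elim!: has_logE)
  then show ?thesis
    by (intro has_logI[of S "\<lambda>z. u z + v z"]) (auto simp: exp_add intro: continuous_intros)
qed

lemma has_log_inverse:
  assumes "has_log S f"
  shows "has_log S (\<lambda>z. inverse (f z))"
proof -
  obtain u where "continuous_on S u" "\<And>z. z \<in> S \<Longrightarrow> f z = exp (u z)"
    using assms by (auto elim!: has_logE)
  then show ?thesis
    by (intro has_logI[of S "\<lambda>z. - u z"]) (auto simp: exp_minus intro: continuous_intros)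
qed

lemma has_log_divide: "has_log S f \<Longrightarrow> has_log S g \<Longrightarrow> has_log S (\<lambda>z. f z / g z)"
  using has_log_mult[OF _ has_log_inverse] by (simp add: divide_inverse)

lemma has_log_const: "a \<noteq> 0 \<Longrightarrow> has_log S (\<lambda>z. a)"
  by (rule has_logI[of S "\<lambda>_. Ln a"]) auto

lemma has_log_prod:
  assumes "\<And>a. a \<in> E \<Longrightarrow> has_log S (f a)"
  shows "has_log S (\<lambda>z. \<Prod>a\<in>E. f a z)"
  using assms by (induction E rule: infinite_finite_induct) (auto intro: has_log_const has_log_mult)

lemma has_log_cancel:
  assumes "has_log S (\<lambda>z. f z * g z)" "has_log S g"
  shows "has_log S f"
  by (rule has_log_cong[OF has_log_divide[OF assms]]) (use has_log_nonzero[OF assms(2)] in auto)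

lemma has_log_compose:
  assumes "has_log T f" "continuous_on S h" "h ` S \<subseteq> T"
  shows "has_log S (\<lambda>z. f (h z))"
proof -
  obtain g where "continuous_on T g" "\<forall>z\<in>T. f z = exp (g z)"
    using assms(1) has_log_def by blast
  then show ?thesis
    unfolding has_log_def using assms(2,3)
    by (intro exI[of _ "\<lambda>z. g (h z)"]) (auto intro: continuous_on_compose2)
qed

text \<open>The principal branch is continuous on the right half-plane. This serves as a Rouche-type
  tool: a field and a sufficiently small perturbation of it differ by a factor of positive real
  part.\<close>

lemma has_log_Re_pos:
  assumes "continuous_on S f" "\<And>z. z \<in> S \<Longrightarrow> Re (f z) > 0"
  shows "has_log S f"
  unfolding has_log_def
proof (intro exI conjI ballI)
  show "continuous_on S (\<lambda>z. Ln (f z))"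
  proof (rule continuous_on_Ln'[OF assms(1)])
    show "f z \<notin> \<real>\<^sub>\<le>\<^sub>0" if "z \<in> S" for z
      using assms(2)[OF that] by (auto simp: complex_nonpos_Reals_iff)
  qed
  show "f z = exp (Ln (f z))" if "z \<in> S" for z
    using assms(2)[OF that] by (subst exp_Ln) auto
qed

lemma simply_connected_has_log:
  assumes "open S" "simply_connected S" "continuous_on S f" "\<And>z. z \<in> S \<Longrightarrow> f z \<noteq> 0"
  shows "has_log S f"
  using assms simply_connected_eq_continuous_log[of S] unfolding has_log_def by blast

section \<open>Circles and winding numbers\<close>

lemma cis_circle_image:
  assumes "r > 0"
  shows "(\<lambda>t. p + of_real r * cis (2*pi * t)) ` {0..1} = sphere p r"
  using path_image_circlepath_nonneg[of r p] assms
  by (simp add: circlepath path_image_def cis_conv_exp mult_ac)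

lemma cis_eq_on_unit_interval:
  assumes "cis (2*pi * s) = cis (2*pi * t)" "s \<in> {0..1}" "t \<in> {0..1}"
  shows "s = t \<or> (s = 0 \<and> t = 1) \<or> (s = 1 \<and> t = 0)"
proof -
  have "exp (\<i> * of_real (2*pi * s)) = exp (\<i> * of_real (2*pi * t))"
    using assms(1) by (simp add: cis_conv_exp)
  then obtain n :: int where "\<i> * of_real (2*pi * s) = \<i> * of_real (2*pi * t) + of_int (2 * n) * pi * \<i>"
    unfolding exp_eq by blast
  then have "Im (\<i> * of_real (2*pi * s)) = Im (\<i> * of_real (2*pi * t) + of_int (2 * n) * pi * \<i>)"
    by simp
  then have "2*pi * s = 2*pi * t + 2*n*pi" by simp
  then have "pi * s = pi * (t + n)" by (simp add: algebra_simps)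
  then have "s = t + n" by simp
  moreover have "n = 0 \<or> n = 1 \<or> n = -1"
    using assms(2,3) calculation by simp linarith
  ultimately show ?thesis using assms(2,3) by auto
qed

text \<open>The parametrisation identifies only the two endpoints, so a loop factors through the
  circle. The factor is continuous because its graph is a compact image of the unit
  interval.\<close>

lemma loop_descends_to_circle:
  fixes u :: "real \<Rightarrow> complex"
  assumes "r > 0" "continuous_on {0..1} u" "u 0 = u 1"
  obtains v where "continuous_on (sphere p r) v"
    "\<And>t. t \<in> {0..1} \<Longrightarrow> v (p + of_real r * cis (2*pi * t)) = u t"
proof -
  define k where "k = (\<lambda>t. p + of_real r * cis (2*pi * t))"
  have contk: "continuous_on {0..1} k"
    unfolding k_def by (intro continuous_intros)
  have well: "u s = u t" if "k s = k t" "s \<in> {0..1}" "t \<in> {0..1}" for s t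
    using cis_eq_on_unit_interval[of s t] that assms by (auto simp: k_def)
  have im: "k ` {0..1} = sphere p r"
    unfolding k_def by (rule cis_circle_image[OF assms(1)])
  define v where "v = (\<lambda>x. u (SOME t. t \<in> {0..1} \<and> k t = x))"
  have v: "v (k t) = u t" if "t \<in> {0..1}" for t
    unfolding v_def using that
    by (metis (mono_tags, lifting) someI_ex well)
  have "(\<lambda>x. (x, v x)) ` sphere p r = (\<lambda>t. (k t, u t)) ` {0..1}"
    using v by (auto simp: im[symmetric] image_image)
  moreover have "compact ((\<lambda>t. (k t, u t)) ` {0..1})"
    by (intro compact_continuous_image continuous_intros contk assms) auto
  ultimately have "closed ((\<lambda>x. (x, v x)) ` sphere p r)"
    by (simp add: compact_imp_closed)
  moreover have "v \<in> sphere p r \<rightarrow> u ` {0..1}"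
    using v by (auto simp: im[symmetric])
  moreover have "compact (u ` {0..1})"
    using assms by (intro compact_continuous_image) auto
  ultimately have "continuous_on (sphere p r) v"
    by (intro continuous_from_closed_graph)
  with v that show ?thesis by (simp add: k_def)
qed

text \<open>Along the circle a logarithm of \<open>F\<close> gains 2 pi i in one turn, exactly as a
  logarithm of \<open>z - p\<close> does. Their difference therefore closes up and lives on the
  circle itself.\<close>

lemma winding_number_has_log_quotient:
  assumes "r > 0" "continuous_on (sphere p r) F" "\<And>z. z \<in> sphere p r \<Longrightarrow> F z \<noteq> 0"
    and w: "winding_number (\<lambda>t. F (p + of_real r * cis (2*pi * t))) 0 = 1"
  shows "has_log (sphere p r) (\<lambda>z. F z / (z - p))"
proof -
  define k where "k = (\<lambda>t. p + of_real r * cis (2*pi * t))"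
  have contk: "continuous_on {0..1} k"
    unfolding k_def by (intro continuous_intros)
  have im: "k ` {0..1} = sphere p r"
    unfolding k_def by (rule cis_circle_image[OF assms(1)])
  have "path (\<lambda>t. F (k t))"
    unfolding path_def using im by (intro continuous_on_compose2[OF assms(2) contk]) auto
  moreover have "0 \<notin> path_image (\<lambda>t. F (k t))"
    using im assms(3) by (force simp: path_image_def)
  ultimately obtain q where q: "path q"
    "pathfinish q - pathstart q = 2 * of_real pi * \<i> * winding_number (\<lambda>t. F (k t)) 0"
    "\<And>t. t \<in> {0..1} \<Longrightarrow> F (k t) = 0 + exp (q t)"
    using winding_number_as_continuous_log by blast
  have q1: "q 1 = q 0 + 2 * of_real pi * \<i>"
    using q(2) w by (simp add: k_def pathfinish_def pathstart_def algebra_simps)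
  define u where "u = (\<lambda>t. q t - of_real (2*pi * t) * \<i> - Ln (of_real r))"
  have "continuous_on {0..1} u"
    using q(1) unfolding u_def path_def by (intro continuous_intros)
  moreover have "u 0 = u 1" by (simp add: u_def q1)
  ultimately obtain v where v: "continuous_on (sphere p r) v"
    "\<And>t. t \<in> {0..1} \<Longrightarrow> v (k t) = u t"
    using loop_descends_to_circle[OF assms(1), of u p] unfolding k_def by metis
  show ?thesis
    unfolding has_log_def
  proof (intro exI conjI ballI)
    fix z assume "z \<in> sphere p r"
    then obtain t where t: "t \<in> {0..1}" "z = k t" using im by blast
    have "exp (u t) = exp (q t) / (cis (2*pi * t) * of_real r)"
      unfolding u_def using assms(1) by (simp add: exp_diff cis_conv_exp mult_ac del: of_real_mult)
    also have "\<dots> = F z / (z - p)" using q(3) t by (simp add: k_def)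
    finally show "F z / (z - p) = exp (v z)" using v t by simp
  qed (fact v)
qed

text \<open>Subtracting 2 pi n t i from a logarithm along the circle leaves a function whose
  exponential is constant. Its values are at least 2 pi apart when distinct, so it is constant,
  while its endpoint values differ by 2 pi n i.\<close>

lemma power_has_no_log_on_circle:
  assumes "r > 0" "has_log (sphere 0 r) (\<lambda>w. w ^ n)"
  shows "n = 0"
proof -
  define k where "k = (\<lambda>t. of_real r * cis (2*pi * t))"
  have contk: "continuous_on {0..1} k"
    unfolding k_def by (intro continuous_intros)
  have im: "k ` {0..1} = sphere 0 r"
    using cis_circle_image[OF assms(1), of 0] unfolding k_def by simp
  obtain h :: "complex \<Rightarrow> complex" where h: "continuous_on (sphere 0 r) h" "\<And>w. w \<in> sphere 0 r \<Longrightarrow> w ^ n = exp (h w)"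
    using assms(2) unfolding has_log_def by blast
  define u where "u = (\<lambda>t. h (k t) - of_real (2*pi * n * t) * \<i>)"
  have "continuous_on {0..1} u"
    unfolding u_def using im by (intro continuous_intros continuous_on_compose2[OF h(1) contk]) auto
  moreover have eu: "exp (u t) = of_real (r ^ n)" if "t \<in> {0..1}" for t
  proof -
    have "exp (u t) = k t ^ n / cis (2*pi * n * t)"
    proof -
      have "k t \<in> sphere 0 r" using im that by blast
      then have "k t ^ n = exp (h (k t))" by (rule h(2))
      then show ?thesis
        by (simp add: u_def exp_diff cis_conv_exp mult_ac)
    qed
    also have "cis (2*pi * n * t) = cis (2*pi * t) ^ n"
      by (simp add: Complex.DeMoivre mult_ac)
    finally show ?thesis by (simp add: k_def power_mult_distrib)
  qed
  have "\<exists>e>0. \<forall>y. y \<in> {0..1} \<and> u y \<noteq> u x \<longrightarrow> e \<le> norm (u y - u x)" if x: "x \<in> {0..1}" for x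
  proof (intro exI[of _ "2*pi"] conjI allI impI)
    fix y assume y: "y \<in> {0..1} \<and> u y \<noteq> u x"
    then have "exp (u y) = exp (u x)" using eu x by simp
    then obtain m :: int where m: "u y = u x + of_int (2 * m) * pi * \<i>"
      unfolding exp_eq by blast
    with y have "m \<noteq> 0" by auto
    then have "1 \<le> \<bar>real_of_int m\<bar>" by linarith
    then show "2*pi \<le> norm (u y - u x)" using m by (simp add: norm_mult)
  qed simp
  ultimately have "u constant_on {0..1}"
    by (intro continuous_discrete_range_constant) simp_all
  then have "u 0 = u 1" unfolding constant_on_def by (metis atLeastAtMost_iff order_refl zero_le_one)
  then show ?thesis by (simp add: u_def k_def)
qed

text \<open>A circle enclosing all zeros would give the contradiction, but \<open>U - K\<close> need
  not contain a round one. The Riemann map to the unit disc supplies a curve in its place: the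
  preimage of a concentric circle close to the unit circle.\<close>

lemma polynomial_has_no_log_near_boundary:
  assumes U: "open U" "simply_connected U" "bounded U"
    and K: "compact K" "K \<subseteq> U" and E: "finite E" "E \<noteq> {}" "E \<subseteq> K"
  shows "\<not> has_log (U - K) (\<lambda>z. \<Prod>a\<in>E. z - a)"
proof
  assume L: "has_log (U - K) (\<lambda>z. \<Prod>a\<in>E. z - a)"
  have "U \<noteq> {}" "U \<noteq> UNIV" using E K U not_bounded_UNIV by auto
  then obtain f g where f: "f holomorphic_on U" and g: "g holomorphic_on ball 0 1"
    and fg: "\<And>z. z \<in> U \<Longrightarrow> f z \<in> ball 0 1 \<and> g (f z) = z"
            "\<And>w. w \<in> ball 0 1 \<Longrightarrow> g w \<in> U \<and> f (g w) = w"
    using Riemann_mapping_theorem[of U] U by metis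
  have inj: "inj_on f U" by (metis fg(1) inj_onI)
  \<comment> \<open>These difference quotients are zero-free because \<open>f\<close> is injective,
    with nonvanishing derivative. Replacing \<open>z - a\<close> by \<open>f z - f a\<close> thus
    costs only a factor that has a logarithm on all of \<open>U\<close>.\<close>
  define \<Phi> where "\<Phi> = (\<lambda>a z. if z = a then deriv f a else (f z - f a) / (z - a))"
  have "has_log U (\<Phi> a)" if "a \<in> E" for a
  proof (rule simply_connected_has_log[OF U(1,2)])
    have a: "a \<in> U" using that E K by auto
    show "continuous_on U (\<Phi> a)"
      using pole_lemma_open[OF f U(1), of a] unfolding \<Phi>_def
      by (rule holomorphic_on_imp_continuous_on)
    show "\<Phi> a z \<noteq> 0" if "z \<in> U" for z
      using that a inj holomorphic_injective_imp_regular[OF f U(1) inj a]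
      by (auto simp: \<Phi>_def dest: inj_onD)
  qed
  then have "has_log (U - K) (\<lambda>z. \<Prod>a\<in>E. \<Phi> a z)"
    by (intro has_log_prod) (blast intro: has_log_subset)
  from has_log_mult[OF L this] have "has_log (U - K) (\<lambda>z. \<Prod>a\<in>E. f z - f a)"
    by (rule has_log_cong) (simp add: \<Phi>_def prod.distrib[symmetric], auto intro!: prod.cong)
  have compact: "compact (f ` K)"
    using K f by (meson compact_continuous_image continuous_on_subset holomorphic_on_imp_continuous_on)
  obtain b where b: "b < 1" "f ` K \<subseteq> cball 0 b"
  proof -
    have "compact ((norm \<circ> f) ` K)"
      using compact_continuous_image[OF continuous_on_norm_id compact]
      by (simp add: image_comp)
    moreover have "(norm \<circ> f) ` K \<noteq> {}" using E by auto
    ultimately obtain x where "x \<in> K" "\<forall>y\<in>K. norm (f y) \<le> norm (f x)"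
      using compact_attains_sup[of "(norm \<circ> f) ` K"] by auto
    moreover from this have "norm (f x) < 1" using fg(1)[of x] K by auto
    ultimately show ?thesis by (intro that[of "norm (f x)"]) auto
  qed
  \<comment> \<open>Any radius strictly between \<open>b\<close> and 1 works; the maximum with 1/2
    makes it positive without a discussion of the sign of \<open>b\<close>.\<close>
  define r where "r = max (1/2) ((1 + b) / 2)"
  have r: "0 < r" "r < 1" "f ` K \<subseteq> ball 0 r"
    using b by (auto simp: r_def less_max_iff_disj image_subset_iff) (smt (verit, best) field_sum_of_halves)?
  have "g ` sphere 0 r \<subseteq> U - K"
    using r fg by force
  moreover have "continuous_on (sphere 0 r) g"
    using g r by (intro continuous_on_subset[OF holomorphic_on_imp_continuous_on]) auto
  ultimately have "has_log (sphere 0 r) (\<lambda>w. \<Prod>a\<in>E. f (g w) - f a)"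
    using has_log_compose[OF \<open>has_log (U - K) (\<lambda>z. \<Prod>a\<in>E. f z - f a)\<close>] by blast
  then have L': "has_log (sphere 0 r) (\<lambda>w. \<Prod>a\<in>E. w - f a)"
    by (rule has_log_cong) (use r fg in \<open>auto intro!: prod.cong\<close>)
  \<comment> \<open>All the points \<open>f a\<close> lie inside the circle, so each
    \<open>w - f a\<close> is \<open>w\<close> times a factor in the unit disc about 1. Only the
    power of \<open>w\<close> remains.\<close>
  have "has_log (sphere 0 r) (\<lambda>w. 1 - f a / w)" if "a \<in> E" for a
  proof (rule has_log_Re_pos)
    show "continuous_on (sphere 0 r) (\<lambda>w. 1 - f a / w)"
      using r by (intro continuous_intros) auto
    fix w :: complex assume w: "w \<in> sphere 0 r"
    have "f a \<in> ball 0 r" using r that E by blast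
    then have "norm (f a) < r" by simp
    then have "norm (f a / w) < 1" using w r by (simp add: norm_divide)
    then show "Re (1 - f a / w) > 0" using complex_Re_le_cmod[of "f a / w"] by simp
  qed
  then have "has_log (sphere 0 r) (\<lambda>w. \<Prod>a\<in>E. 1 - f a / w)"
    by (rule has_log_prod)
  from has_log_divide[OF L' this] have "has_log (sphere 0 r) (\<lambda>w. w ^ card E)"
  proof (rule has_log_cong)
    fix w :: complex assume w: "w \<in> sphere 0 r"
    then have "w \<noteq> 0" using r by auto
    then have "(\<Prod>a\<in>E. w - f a) = (\<Prod>a\<in>E. w * (1 - f a / w))"
      by (intro prod.cong) (auto simp: field_simps)
    also have "\<dots> = w ^ card E * (\<Prod>a\<in>E. 1 - f a / w)"
      by (simp add: prod.distrib)
    moreover have "(\<Prod>a\<in>E. 1 - f a / w) \<noteq> 0"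
      using has_log_nonzero[OF \<open>has_log (sphere 0 r) (\<lambda>w. \<Prod>a\<in>E. 1 - f a / w)\<close> w] .
    ultimately show "w ^ card E = (\<Prod>a\<in>E. w - f a) / (\<Prod>a\<in>E. 1 - f a / w)" by simp
  qed
  then have "card E = 0" by (rule power_has_no_log_on_circle[OF r(1)])
  with E show False by simp
qed

section \<open>Removing zeros of index one\<close>

lemma has_log_diff_cball:
  assumes "a \<notin> cball p r"
  shows "has_log (cball p r) (\<lambda>z. z - a)"
proof -
  have "p \<noteq> a \<or> r < 0" using assms by auto
  then consider "p \<noteq> a" | "cball p r = {}" by fastforce
  then show ?thesis
  proof cases
    case 1
    have "has_log (cball p r) (\<lambda>z. 1 + (z - p) / (p - a))"
    proof (rule has_log_Re_pos)
      show "continuous_on (cball p r) (\<lambda>z. 1 + (z - p) / (p - a))"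
        using 1 by (intro continuous_intros) auto
      fix z assume "z \<in> cball p r"
      then have "norm (z - p) < norm (p - a)" using assms by (auto simp: dist_norm norm_minus_commute)
      then have "norm ((z - p) / (p - a)) < 1" using 1 by (simp add: norm_divide)
      then show "Re (1 + (z - p) / (p - a)) > 0"
        using abs_Re_le_cmod[of "(z - p) / (p - a)"] by simp
    qed
    moreover have "has_log (cball p r) (\<lambda>z. p - a)" using 1 by (intro has_log_const) auto
    ultimately have "has_log (cball p r) (\<lambda>z. (1 + (z - p) / (p - a)) * (p - a))"
      by (rule has_log_mult)
    then show ?thesis by (rule has_log_cong) (use 1 in \<open>simp add: field_simps\<close>)
  qed (auto intro: has_logI)
qed

text \<open>At a zero \<open>p\<close> of index one the quotient by \<open>z - p\<close> has a
  logarithm on a small circle. Extending that logarithm over the disc by Tietze and exponentiating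
  replaces the zero by nonzero values. The compact set \<open>C\<close> covers the discs on which
  the field is altered.\<close>

lemma divide_out_simple_zeros:
  assumes "finite E" "open V" "E \<subseteq> V" "continuous_on (V - E) F" "\<And>z. z \<in> V - E \<Longrightarrow> F z \<noteq> 0"
    and "\<And>p. p \<in> E \<Longrightarrow> \<exists>\<epsilon>>0. \<forall>r. 0 < r \<and> r < \<epsilon> \<longrightarrow> has_log (sphere p r) (\<lambda>z. F z / (z - p))"
  shows "\<exists>G C. continuous_on V G \<and> (\<forall>z\<in>V. G z \<noteq> 0) \<and> compact C \<and> E \<subseteq> C \<and> C \<subseteq> V \<and>
           (\<forall>z\<in>V - C. F z = G z * (\<Prod>a\<in>E. z - a))"
  using assms
proof (induction E arbitrary: V rule: finite_induct)
  case empty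
  then show ?case by (intro exI[of _ F] exI[of _ "{}"]) auto
next
  case (insert p E)
  have "V - {p} - E = V - insert p E" by blast
  \<comment> \<open>The other zeros are treated first, in \<open>V\<close> without \<open>p\<close>;
    the resulting \<open>C'\<close> then avoids \<open>p\<close>, which leaves room for a disc
    around it.\<close>
  then have "\<exists>G C. continuous_on (V - {p}) G \<and> (\<forall>z\<in>V - {p}. G z \<noteq> 0) \<and> compact C \<and> E \<subseteq> C \<and> C \<subseteq> V - {p} \<and>
      (\<forall>z\<in>V - {p} - C. F z = G z * (\<Prod>a\<in>E. z - a))"
    using insert.prems insert.hyps by (intro insert.IH) auto
  then obtain G' C' where G': "continuous_on (V - {p}) G'" "\<And>z. z \<in> V - {p} \<Longrightarrow> G' z \<noteq> 0"
    and C': "compact C'" "E \<subseteq> C'" "C' \<subseteq> V - {p}"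
    and F: "\<And>z. z \<in> V - {p} - C' \<Longrightarrow> F z = G' z * (\<Prod>a\<in>E. z - a)"
    by blast
  obtain \<epsilon> where \<epsilon>: "\<epsilon> > 0" "\<And>r. 0 < r \<Longrightarrow> r < \<epsilon> \<Longrightarrow> has_log (sphere p r) (\<lambda>z. F z / (z - p))"
    using insert.prems(5)[of p] by blast
  have "open (V - C')" "p \<in> V - C'"
    using C' insert.prems by (auto simp: open_Diff compact_imp_closed)
  then obtain d where d: "d > 0" "cball p d \<subseteq> V - C'"
    using open_contains_cball by blast
  define r where "r = min d (\<epsilon> / 2)"
  have r: "r > 0" "r < \<epsilon>" "cball p r \<subseteq> V - C'"
    using d \<epsilon>(1) by (auto simp: r_def)
  \<comment> \<open>The disc avoids \<open>C'\<close> and hence \<open>E\<close>, so the factors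
    already divided out have logarithms on it, and \<open>G'\<close> inherits the index condition at
    \<open>p\<close> from \<open>F\<close>.\<close>
  have "has_log (sphere p r) (\<lambda>z. \<Prod>a\<in>E. z - a)"
    using r(3) C'(2) by (intro has_log_prod has_log_subset[OF has_log_diff_cball]) auto
  from has_log_divide[OF \<epsilon>(2)[OF r(1,2)] this]
  have "has_log (sphere p r) (\<lambda>z. G' z / (z - p))"
  proof (rule has_log_cong)
    fix z assume z: "z \<in> sphere p r"
    then have "z \<in> V - {p} - C'" using r by auto
    from F[OF this] show "G' z / (z - p) = F z / (z - p) / (\<Prod>a\<in>E. z - a)"
      using has_log_nonzero[OF \<open>has_log (sphere p r) (\<lambda>z. \<Prod>a\<in>E. z - a)\<close> z] by simp
  qed
  then obtain h :: "complex \<Rightarrow> complex" where h: "continuous_on (sphere p r) h"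
    "\<And>z. z \<in> sphere p r \<Longrightarrow> G' z / (z - p) = exp (h z)"
    by (rule has_logE) blast
  obtain h' where h': "continuous_on UNIV h'" "\<And>z. z \<in> sphere p r \<Longrightarrow> h' z = h z"
    using Tietze_unbounded[OF h(1), of UNIV] by auto
  define G where "G = (\<lambda>z. if z \<in> cball p r then exp (h' z) else G' z / (z - p))"
  have V: "V = cball p r \<union> (V - ball p r)" using r by auto
  have "continuous_on (cball p r \<union> (V - ball p r)) G"
    unfolding G_def
  proof (rule continuous_on_cases_local)
    show "closedin (top_of_set (cball p r \<union> (V - ball p r))) (cball p r)"
      by (rule closed_subset) auto
    have "V - ball p r = (cball p r \<union> (V - ball p r)) \<inter> - ball p r" using V by blast
    then show "closedin (top_of_set (cball p r \<union> (V - ball p r))) (V - ball p r)"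
      by (metis closed_Compl closedin_closed_Int open_ball)
    show "continuous_on (cball p r) (\<lambda>z. exp (h' z))"
      by (intro continuous_intros continuous_on_subset[OF h'(1)]) auto
    show "continuous_on (V - ball p r) (\<lambda>z. G' z / (z - p))"
      using r(1) by (intro continuous_intros continuous_on_subset[OF G'(1)]) auto
    show "exp (h' z) = G' z / (z - p)"
      if "z \<in> cball p r \<and> z \<notin> cball p r \<or> z \<in> V - ball p r \<and> z \<in> cball p r" for z
      using that h(2)[of z] h'(2)[of z] by auto
  qed
  with V have "continuous_on V G" by simp
  moreover have "\<forall>z\<in>V. G z \<noteq> 0"
  proof
    fix z assume "z \<in> V"
    show "G z \<noteq> 0"
    proof (cases "z \<in> cball p r")
      case False
      then have "z \<noteq> p" using r(1) by auto
      then show ?thesis using G'(2)[of z] \<open>z \<in> V\<close> False by (simp add: G_def)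
    qed (simp add: G_def)
  qed
  moreover have "compact (C' \<union> cball p r)" "insert p E \<subseteq> C' \<union> cball p r" "C' \<union> cball p r \<subseteq> V"
    using C' r by (auto intro: compact_Un)
  moreover have "F z = G z * (\<Prod>a\<in>insert p E. z - a)" if "z \<in> V - (C' \<union> cball p r)" for z
  proof -
    have "z \<noteq> p" "z \<in> V - {p} - C'" using that r by auto
    then show ?thesis using F[of z] that insert.hyps by (simp add: G_def)
  qed
  ultimately show ?case by blast
qed

proposition index_one_zeros_no_log_near_boundary:
  assumes U: "open U" "simply_connected U" "bounded U"
    and K: "compact K" "K \<subseteq> U" and E: "finite E" "E \<noteq> {}" "E \<subseteq> U"
    and F: "continuous_on (U - E) F" "\<And>z. z \<in> U - E \<Longrightarrow> F z \<noteq> 0"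
      "\<And>p. p \<in> E \<Longrightarrow> \<exists>\<epsilon>>0. \<forall>r. 0 < r \<and> r < \<epsilon> \<longrightarrow> has_log (sphere p r) (\<lambda>z. F z / (z - p))"
  shows "\<not> has_log (U - K) F"
proof
  assume L: "has_log (U - K) F"
  obtain G C where G: "continuous_on U G" "\<forall>z\<in>U. G z \<noteq> 0" and C: "compact C" "E \<subseteq> C" "C \<subseteq> U"
    and eq: "\<And>z. z \<in> U - C \<Longrightarrow> F z = G z * (\<Prod>a\<in>E. z - a)"
    using divide_out_simple_zeros[OF E(1) U(1) E(3) F] by blast
  have "has_log U G"
    using simply_connected_has_log U G by blast
  \<comment> \<open>The factorisation of \<open>F\<close> holds only off \<open>C\<close>, so the
    excluded compact set grows to include it.\<close>
  then have "has_log (U - (K \<union> C)) G" by (rule has_log_subset) auto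
  moreover have "has_log (U - (K \<union> C)) (\<lambda>z. (\<Prod>a\<in>E. z - a) * G z)"
    by (rule has_log_cong[OF has_log_subset[OF L]]) (auto simp: eq)
  ultimately have "has_log (U - (K \<union> C)) (\<lambda>z. \<Prod>a\<in>E. z - a)"
    by (rule has_log_cancel[rotated])
  moreover have "\<not> has_log (U - (K \<union> C)) (\<lambda>z. \<Prod>a\<in>E. z - a)"
    using K C E by (intro polynomial_has_no_log_near_boundary U) (auto intro: compact_Un)
  ultimately show False by contradiction
qed

section \<open>Regular level curves\<close>

text \<open>Both boundaries become instances with the same \<open>\<psi>\<close> and
  \<open>g\<close>, at different levels. The plane is taken to be the complex numbers so that
  quotients of vectors, and logarithms of them, make sense.\<close>

locale regular_level_curve =
  fixes \<psi> :: "complex \<Rightarrow> real" and g :: "complex \<Rightarrow> complex" and c :: real and L :: "complex set"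
  assumes has_gradient: "\<And>x. (\<psi> has_derivative (\<lambda>h. g x \<bullet> h)) (at x)"
    and continuous_gradient: "continuous_on UNIV g"
    and L_eq: "L = {x. \<psi> x = c}"
    and compact_L: "compact L" and connected_L: "connected L" and L_nonempty: "L \<noteq> {}"
    and gradient_nonzero: "\<And>x. x \<in> L \<Longrightarrow> g x \<noteq> 0"
begin

lemma continuous_psi: "continuous_on S \<psi>"
  using has_gradient by (meson continuous_at_imp_continuous_on has_derivative_continuous)

text \<open>A uniform substitute for a tubular neighbourhood, obtained from compactness. The base
  point \<open>y\<close> may lie off the curve, because later a point of an arbitrary component near
  the curve has to be moved.\<close>

lemma increasing_along_gradient:
  obtains e where "e > 0"
    "\<And>x y s t. \<lbrakk>x \<in> L; dist x y < e; - e < s; s < t; t < e\<rbrakk>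
        \<Longrightarrow> \<psi> (y + s *\<^sub>R g y) < \<psi> (y + t *\<^sub>R g y)"
proof -
  \<comment> \<open>The inner product is the derivative of \<open>\<psi>\<close> at parameter
    \<open>u\<close> along the segment from \<open>y\<close> in direction \<open>g y\<close>, for
    the pair \<open>(y, u)\<close>; it is positive on the curve at \<open>u = 0\<close>.\<close>
  define T where "T = {z. g (fst z + snd z *\<^sub>R g (fst z)) \<bullet> g (fst z) > 0}"
  have "open T"
    unfolding T_def
    by (intro open_Collect_less continuous_intros continuous_on_compose2[OF continuous_gradient]) auto
  moreover have "L \<times> {0} \<subseteq> T"
    using gradient_nonzero by (auto simp: T_def)
  moreover have "compact (L \<times> {0::real})"
    by (intro compact_Times compact_L) auto
  ultimately obtain e where e: "e > 0" "(\<Union>z\<in>L \<times> {0}. ball z e) \<subseteq> T"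
    using compact_subset_open_imp_ball_epsilon_subset by blast
  have "\<psi> (y + s *\<^sub>R g y) < \<psi> (y + t *\<^sub>R g y)"
    if "x \<in> L" "dist x y < e / 2" "- (e / 2) < s" "s < t" "t < e / 2" for x y s t
  proof (rule DERIV_pos_imp_increasing[OF \<open>s < t\<close>])
    fix u assume u: "s \<le> u" "u \<le> t"
    have "dist (x, 0) (y, u) \<le> dist x y + dist 0 u"
      using sqrt_sum_squares_le_sum[of "dist x y" "dist 0 u"] by (simp add: dist_Pair_Pair)
    also have "\<dots> < e" using that u by (auto simp: dist_real_def)
    finally have "(y, u) \<in> T" using e(2) that by fastforce
    moreover have "((\<lambda>u. \<psi> (y + u *\<^sub>R g y)) has_real_derivative g (y + u *\<^sub>R g y) \<bullet> g y) (at u)"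
      unfolding has_field_derivative_def
      by (rule has_derivative_eq_rhs[OF has_derivative_compose[OF _ has_gradient]])
        (auto intro!: derivative_eq_intros simp: mult_ac)
    ultimately show "\<exists>d. ((\<lambda>u. \<psi> (y + u *\<^sub>R g y)) has_real_derivative d) (at u) \<and> 0 < d"
      by (auto simp: T_def)
  qed
  with e(1) that[of "e / 2"] show ?thesis by auto
qed

text \<open>A Jordan-type separation statement. Pushing the connected curve off itself along plus or
  minus the gradient gives two connected strips, each inside one component. Every component has a
  frontier point on the curve, and near it a point can be moved into one of the strips' components
  without crossing the curve.\<close>

lemma two_sides:
  obtains e W where "e > 0" "W 1 \<noteq> W (- 1)"
    "\<And>s. s \<in> {1, - 1} \<Longrightarrow> W s \<in> components (- L)"
    "\<And>C. C \<in> components (- L) \<Longrightarrow> C = W 1 \<or> C = W (- 1)"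
    "\<And>s t x. \<lbrakk>s \<in> {1, - 1 :: real}; x \<in> L; 0 < t; t < e\<rbrakk> \<Longrightarrow> x + (s * t) *\<^sub>R g x \<in> W s"
proof -
  obtain e where e: "e > 0"
    and inc: "\<And>x y s t. \<lbrakk>x \<in> L; dist x y < e; - e < s; s < t; t < e\<rbrakk>
        \<Longrightarrow> \<psi> (y + s *\<^sub>R g y) < \<psi> (y + t *\<^sub>R g y)"
    by (rule increasing_along_gradient) blast
  define \<sigma> where "\<sigma> = (\<lambda>s t x. x + (s * t :: real) *\<^sub>R g x)"
  have \<sigma>: "continuous_on UNIV (\<sigma> s t)" for s t
    unfolding \<sigma>_def by (intro continuous_intros continuous_gradient)
  have sign: "s * (\<psi> (\<sigma> s t y) - \<psi> y) > 0"
    if "s \<in> {1, - 1}" "x \<in> L" "dist x y < e" "0 < t" "t < e" for s t x y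
    using inc[of x y 0 t] inc[of x y "- t" 0] that by (auto simp: \<sigma>_def)
  define B where "B = (\<lambda>s. (\<lambda>z. \<sigma> s (fst z) (snd z)) ` ({0<..<e} \<times> L))"
  have "connected (B s)" for s
    unfolding B_def \<sigma>_def
    by (intro connected_continuous_image continuous_intros connected_Times connected_L
        continuous_on_compose2[OF continuous_gradient]) auto
  moreover have B_off: "B s \<subseteq> - L" if "s \<in> {1, - 1}" for s
  proof -
    have "\<sigma> s t x \<notin> L" if "x \<in> L" "0 < t" "t < e" for t x
      using sign[of s x x t] that \<open>s \<in> {1, - 1}\<close> e L_eq by auto
    then show ?thesis by (auto simp: B_def)
  qed
  obtain x0 where x0: "x0 \<in> L" using L_nonempty by blast
  define W where "W = (\<lambda>s. connected_component_set (- L) (\<sigma> s (e / 2) x0))"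
  have mem: "\<sigma> s t x \<in> B s" if "x \<in> L" "0 < t" "t < e" for s t x
    using that unfolding B_def by force
  have BW: "B s \<subseteq> W s" if "s \<in> {1, - 1}" for s
    unfolding W_def using calculation B_off[OF that] mem[OF x0, of "e/2" s] e
    by (intro connected_component_maximal) auto
  have comp: "W s \<in> components (- L)" if "s \<in> {1, - 1}" for s
    unfolding W_def using B_off[OF that] mem[OF x0, of "e/2" s] e
    by (intro componentsI) auto
  have above: "\<exists>x\<in>W s. s * (\<psi> x - c) > 0" if "s \<in> {1, - 1}" for s
    using BW[OF that] mem[OF x0, of "e/2" s] sign[of s x0 x0 "e/2"] that x0 e L_eq
    by (intro bexI[of _ "\<sigma> s (e/2) x0"]) auto
  have ne: "W 1 \<noteq> W (- 1)"
  \<comment> \<open>If the two components coincided, \<open>\<psi>\<close> would take values above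
    and below \<open>c\<close> on a connected set that misses the level \<open>c\<close>.\<close>
  proof
    assume eq: "W 1 = W (- 1)"
    obtain x y where "x \<in> W 1" "\<psi> x > c" "y \<in> W 1" "\<psi> y < c"
      using above[of 1] above[of "- 1"] eq by auto
    moreover have "connected (\<psi> ` W 1)"
      by (intro connected_continuous_image continuous_psi) (auto simp: W_def)
    ultimately have "c \<in> \<psi> ` W 1"
      by (meson connected_contains_Icc imageI less_imp_le atLeastAtMost_iff subsetD)
    moreover have "W 1 \<subseteq> - L" by (auto simp: W_def dest: connected_component_in)
    ultimately show False using L_eq by auto
  qed
  have cover: "C = W 1 \<or> C = W (- 1)" if C: "C \<in> components (- L)" for C
  proof -
    have opL: "open (- L)" using compact_L by (simp add: compact_imp_closed open_Compl)
    have "C \<noteq> {}" "C \<subseteq> - L" using C in_components_nonempty in_components_subset by blast+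
    then have "frontier C \<noteq> {}"
      using L_nonempty by (auto simp: frontier_eq_empty)
    moreover have "frontier C \<subseteq> L"
      using frontier_of_components_subset[OF C] compact_L frontier_subset_closed[of L]
      by (auto simp: compact_imp_closed)
    ultimately obtain x where x: "x \<in> L" "x \<in> closure C" by (auto simp: frontier_def)
    \<comment> \<open>Near \<open>x\<close>, a push by \<open>e/2\<close> in either direction
      already lands in the component of the corresponding strip.\<close>
    define N where "N = ball x e \<inter> (\<Inter>s\<in>{1,-1}. \<sigma> s (e/2) -` W s)"
    have "open N"
      unfolding N_def using comp opL \<sigma>
      by (intro open_Int open_INT ballI open_vimage open_ball) (auto intro: open_components)
    moreover have "x \<in> N" using e BW mem[OF x(1), of "e/2"] by (auto simp: N_def)
    ultimately obtain y where y: "y \<in> C" "y \<in> N"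
      using x(2) by (meson closure_iff_nhds_not_empty disjoint_iff order_refl)
    then have "\<psi> y \<noteq> c" using \<open>C \<subseteq> - L\<close> L_eq by auto
    then obtain s :: real where s: "s \<in> {1, - 1}" "s * (\<psi> y - c) > 0"
      by (cases "\<psi> y > c") (auto intro: that[of 1] that[of "-1"])
    \<comment> \<open>The direction follows the sign of \<open>\<psi> y - c\<close>, so the path
      only moves further from the level \<open>c\<close> and never meets \<open>L\<close>.\<close>
    define P where "P = (\<lambda>t. \<sigma> s t y) ` {0..e/2}"
    have "connected P"
      unfolding P_def \<sigma>_def by (intro connected_continuous_image continuous_intros) auto
    moreover have "P \<subseteq> - L"
    proof -
      have "s * (\<psi> (\<sigma> s t y) - c) > 0" if "0 \<le> t" "t \<le> e/2" for t
      proof (cases "t = 0")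
        case False
        then have "s * (\<psi> (\<sigma> s t y) - \<psi> y) > 0"
          using that y x(1) e by (intro sign[OF s(1) x(1)]) (auto simp: N_def)
        with s(2) show ?thesis by (simp add: algebra_simps)
      qed (use s(2) in \<open>simp add: \<sigma>_def\<close>)
      then show ?thesis using L_eq by (fastforce simp: P_def)
    qed
    moreover have "\<sigma> s 0 y \<in> P" "\<sigma> s (e/2) y \<in> P"
      using e unfolding P_def by (intro imageI; simp)+
    moreover have "\<sigma> s 0 y = y" by (simp add: \<sigma>_def)
    moreover have "\<sigma> s (e/2) y \<in> W s" using y(2) s(1) by (auto simp: N_def)
    ultimately have "C = W s"
      using components_maximal[OF C, of P] components_maximal[OF comp[OF s(1)], of P]
        components_eq[OF C comp[OF s(1)]] y(1) by (metis disjoint_iff subset_iff)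
    with s(1) show ?thesis by auto
  qed
  show ?thesis
    using that[OF e ne comp cover] BW mem unfolding \<sigma>_def by blast
qed

text \<open>The outside of a bounded set in the plane is a single component, so the inside is the
  other side. The sign \<open>s\<close> records whether the gradient points inwards or outwards,
  which the hypotheses leave open.\<close>

lemma inside_outside_sides:
  obtains e s where "e > 0" "s \<in> {1, - 1 :: real}" "connected (inside L)"
    "\<And>t x. \<lbrakk>x \<in> L; 0 < t; t < e\<rbrakk> \<Longrightarrow> x + (s * t) *\<^sub>R g x \<in> inside L"
    "\<And>t x. \<lbrakk>x \<in> L; 0 < t; t < e\<rbrakk> \<Longrightarrow> x + (- s * t) *\<^sub>R g x \<in> outside L"
proof -
  obtain e W where e: "e > 0" and ne: "W 1 \<noteq> W (- 1)"
    and comp: "\<And>s. s \<in> {1, - 1} \<Longrightarrow> W s \<in> components (- L)"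
    and cover: "\<And>C. C \<in> components (- L) \<Longrightarrow> C = W 1 \<or> C = W (- 1)"
    and W: "\<And>s t x. \<lbrakk>s \<in> {1, - 1 :: real}; x \<in> L; 0 < t; t < e\<rbrakk> \<Longrightarrow> x + (s * t) *\<^sub>R g x \<in> W s"
    by (rule two_sides) blast
  have "outside L \<in> components (- L)"
    using compact_imp_bounded[OF compact_L] connected_L
    by (simp add: outside_in_components connected_outside outside_bounded_nonempty)
  from cover[OF this] obtain s where s: "s \<in> {1, - 1}" "outside L = W (- s)"
    by (metis add.inverse_inverse insertCI)
  then have "W s \<noteq> outside L" using ne by auto
  have "inside L = W s"
  proof
    show "inside L \<subseteq> W s"
    proof
      fix y assume y: "y \<in> inside L"
      then have "y \<in> - L" using inside_Un_outside by blast
      then have "connected_component_set (- L) y \<in> components (- L)"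
        and y': "y \<in> connected_component_set (- L) y"
        by (auto simp: componentsI)
      then have "connected_component_set (- L) y \<in> {W s, W (- s)}"
        using cover s(1) by fastforce
      moreover have "y \<notin> W (- s)" using s y inside_Int_outside by blast
      ultimately show "y \<in> W s" using y' by auto
    qed
    have "W s \<in> components (- L)" "W s \<inter> outside L = {}"
      using comp[OF s(1)] components_nonoverlap[OF comp[OF s(1)] \<open>outside L \<in> components (- L)\<close>]
        \<open>W s \<noteq> outside L\<close> by auto
    then show "W s \<subseteq> inside L"
      using in_components_subset inside_Un_outside by blast
  qed
  moreover have "connected (W s)" using comp[OF s(1)] in_components_connected by blast
  moreover have "- s \<in> {1, -1}" using s(1) by auto
  ultimately show ?thesis
    using that[OF e s(1)] W[OF s(1)] W[of "- s"] s(2) by simp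
qed

section \<open>Topology of the enclosed region\<close>

lemma connected_inside: "connected (inside L)"
  by (rule inside_outside_sides)

lemma inside_nonempty: "inside L \<noteq> {}"
proof -
  obtain e s where "e > 0" and ray: "\<And>t x. \<lbrakk>x \<in> L; 0 < t; t < e\<rbrakk> \<Longrightarrow> x + (s * t) *\<^sub>R g x \<in> inside L"
    by (rule inside_outside_sides) blast
  moreover obtain x where "x \<in> L" using L_nonempty by blast
  ultimately have "x + (s * (e/2)) *\<^sub>R g x \<in> inside L"
    using ray[of x "e/2"] by simp
  then show ?thesis by blast
qed

lemma in_closure_if_ray:
  fixes x v :: complex
  assumes "e > 0" "\<And>t. 0 < t \<Longrightarrow> t < e \<Longrightarrow> x + (s * t) *\<^sub>R v \<in> S"
  shows "x \<in> closure S"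
proof -
  have "((\<lambda>t. x + (s * t) *\<^sub>R v) \<longlongrightarrow> x + (s * 0) *\<^sub>R v) (at_right 0)"
    by (intro tendsto_intros)
  moreover have "\<forall>\<^sub>F t in at_right 0. x + (s * t) *\<^sub>R v \<in> closure S"
    using eventually_at_right_real[OF assms(1)] by eventually_elim (use assms(2) closure_subset in auto)
  ultimately show ?thesis
    using Lim_in_closed_set[of "closure S"] by fastforce
qed

lemma subset_closure_inside: "L \<subseteq> closure (inside L)"
  by (rule inside_outside_sides) (blast intro: in_closure_if_ray)

lemma subset_closure_outside: "L \<subseteq> closure (outside L)"
  by (rule inside_outside_sides) (blast intro: in_closure_if_ray)

lemma open_inside: "open (inside L)"
  using compact_L by (simp add: compact_imp_closed open_inside)

lemma bounded_inside: "bounded (inside L)"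
  using compact_L by (simp add: compact_imp_bounded bounded_inside)

text \<open>Since \<open>L\<close> is connected, the complement of a component of \<open>- L\<close>
  is connected; for a bounded open connected plane set this is simple connectivity.\<close>

lemma simply_connected_inside: "simply_connected (inside L)"
proof -
  have "inside L \<in> components (- L)"
    using connected_inside inside_nonempty by (simp add: inside_in_components)
  then have "connected (- inside L)"
    using component_complement_connected connected_L by blast
  then show ?thesis
    using simply_connected_iff_simple[OF open_inside bounded_inside] connected_inside by blast
qed

text \<open>The rotation index of the normal field is one: up to a nonzero real factor, the gradient at
  \<open>x\<close> is \<open>y - x\<close> for a point \<open>y\<close> inside the curve, and \<open>y\<close> can be contracted to \<open>q\<close> inside the
  curve without ever meeting \<open>x\<close>.\<close>
lemma gradient_has_log:
  obtains q where "q \<in> inside L" "has_log L (\<lambda>x. g x / (x - q))"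
proof -
  obtain e s where e: "e > 0" and s: "s \<in> {1, - 1 :: real}"
    and ray: "\<And>t x. \<lbrakk>x \<in> L; 0 < t; t < e\<rbrakk> \<Longrightarrow> x + (s * t) *\<^sub>R g x \<in> inside L"
    by (rule inside_outside_sides) blast
  define a where "a = s * (e / 2)"
  have a: "a \<noteq> 0" "\<And>x. x \<in> L \<Longrightarrow> x + a *\<^sub>R g x \<in> inside L"
    using ray[of _ "e/2"] e s by (auto simp: a_def)
  have "contractible (inside L)"
    using simply_connected_inside open_inside contractible_eq_simply_connected_2d by blast
  then obtain q where "homotopic_with_canon (\<lambda>_. True) (inside L) (inside L) id (\<lambda>_. q)"
    unfolding contractible_def by blast
  then obtain h where "continuous_map (prod_topology (top_of_set {0..1::real}) (top_of_set (inside L)))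
      (top_of_set (inside L)) h" and h01: "\<And>x. h (0, x) = x" "\<And>x. h (1, x) = q"
    unfolding homotopic_with_def by auto
  then have h: "continuous_on ({0..1} \<times> inside L) h" "h ` ({0..1} \<times> inside L) \<subseteq> inside L"
    by (auto simp: prod_topology_subtopology_eu)
  have q: "q \<in> inside L"
  proof -
    obtain w where "w \<in> inside L" using inside_nonempty by blast
    then have "h (1, w) \<in> inside L" using h(2) by (simp add: image_subset_iff)
    then show ?thesis using h01(2) by simp
  qed
  \<comment> \<open>The numerator deforms \<open>a *\<^sub>R g x\<close> into \<open>q - x\<close>;
    dividing by \<open>q - x\<close> makes the final map the constant 1.\<close>
  define k where "k = (\<lambda>z. (h (fst z, snd z + a *\<^sub>R g (snd z)) - snd z) / (q - snd z))"
  have off: "y - x \<noteq> 0" if "x \<in> L" "y \<in> inside L" for x y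
  proof -
    have "y \<notin> L" using that inside_no_overlap[of L] by blast
    with that show ?thesis by auto
  qed
  have cont: "continuous_on ({0..1} \<times> L) k"
  proof -
    have "continuous_on ({0..1} \<times> L) (\<lambda>z. g (snd z))"
      by (rule continuous_on_compose2[OF continuous_gradient]) (auto intro: continuous_intros)
    then have "continuous_on ({0..1} \<times> L) (\<lambda>z. (fst z, snd z + a *\<^sub>R g (snd z)))"
      by (intro continuous_intros)
    then have "continuous_on ({0..1} \<times> L) (\<lambda>z. h (fst z, snd z + a *\<^sub>R g (snd z)))"
      by (rule continuous_on_compose2[OF h(1)]) (use a(2) in auto)
    moreover have "q - snd z \<noteq> 0" if "z \<in> {0..1::real} \<times> L" for z
      using off[of "snd z" q] q that by auto
    ultimately show ?thesis
      unfolding k_def by (intro continuous_on_divide continuous_on_diff continuous_on_snd continuous_on_id) auto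
  qed
  have "homotopic_with_canon (\<lambda>_. True) L (- {0}) (\<lambda>x. k (0, x)) (\<lambda>x. k (1, x))"
    unfolding homotopic_with_def
  proof (intro exI[of _ k] conjI allI ballI)
    have "k (t, x) \<noteq> 0" if "t \<in> {0..1}" "x \<in> L" for t x
    proof -
      have "h (t, x + a *\<^sub>R g x) \<in> inside L"
        using h(2) a(2)[OF that(2)] that(1) by blast
      then show ?thesis
        using off[OF that(2) q] off[OF that(2), of "h (t, x + a *\<^sub>R g x)"] by (simp add: k_def)
    qed
    then show "continuous_map (prod_topology (top_of_set {0..1}) (top_of_set L)) (top_of_set (- {0})) k"
      using cont by (auto simp: prod_topology_subtopology_eu)
  qed auto
  then have "homotopic_with_canon (\<lambda>_. True) L (- {0}) (\<lambda>x. k (0, x)) (\<lambda>x. 1)"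
    by (rule homotopic_with_eq) (use off[OF _ q] in \<open>simp_all add: k_def h01\<close>)
  \<comment> \<open>A map homotopic to a constant in the punctured plane is the exponential of a
    continuous function.\<close>
  then have "has_log L (\<lambda>x. k (0, x))"
    unfolding has_log_def by (intro inessential_eq_continuous_logarithm[THEN iffD1] exI)
  moreover have "has_log L (\<lambda>x. - complex_of_real a)" using a(1) by (intro has_log_const) auto
  ultimately have "has_log L (\<lambda>x. k (0, x) / (- complex_of_real a))" by (rule has_log_divide)
  then have "has_log L (\<lambda>x. g x / (x - q))"
  proof (rule has_log_cong)
    fix x assume "x \<in> L"
    show "g x / (x - q) = k (0, x) / - complex_of_real a"
    proof -
      have "k (0, x) = of_real a * g x / (q - x)"
        by (simp add: k_def h01 scaleR_conv_of_real)
      then have "k (0, x) / - complex_of_real a = - (g x / (q - x))"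
        using a(1) by simp
      then show ?thesis by (metis minus_diff_eq minus_divide_right)
    qed
  qed
  with q that show ?thesis by blast
qed

end

section \<open>The index count for blended fields\<close>

text \<open>Here \<open>A\<close> and \<open>B\<close> stand for the normalised path-following and
  reactive fields. All that is kept of the guiding structure is the logarithm of
  \<open>B / g\<close> on \<open>Q\<close>: the reactive field has the same index there as the
  normal. \<open>B\<close> is given only on \<open>Q\<close> and \<open>M\<close>, since the
  reactive field may be singular further inside.\<close>

proposition blended_field_zeros_not_all_index_one:
  fixes A B F :: "complex \<Rightarrow> complex" and s z :: "complex \<Rightarrow> real"
  assumes R: "regular_level_curve \<psi> g b R" and Q: "regular_level_curve \<psi> g c Q"
    and disjoint: "Q \<inter> R = {}" and nested: "inside Q \<subseteq> inside R"
    and M: "M = outside Q \<inter> inside R"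
    and A: "continuous_on (inside R) A" "\<And>x. x \<in> inside R \<Longrightarrow> norm (A x) = 1"
    and B: "continuous_on (Q \<union> M) B" "\<And>x. x \<in> Q \<union> M \<Longrightarrow> norm (B x) = 1"
      "has_log Q (\<lambda>x. B x / g x)"
    and s: "continuous_on UNIV s" "\<And>x. x \<in> R \<Longrightarrow> s x = 1" "\<And>x. x \<in> Q \<union> inside Q \<Longrightarrow> s x = 0"
      "\<And>x. x \<in> M \<Longrightarrow> s x \<ge> 0"
    and z: "continuous_on UNIV z" "\<And>x. x \<in> R \<Longrightarrow> z x = 0" "\<And>x. x \<in> Q \<union> inside Q \<Longrightarrow> z x = 1"
      "\<And>x. x \<in> M \<Longrightarrow> z x \<ge> 0"
    and F: "\<And>x. x \<in> M \<Longrightarrow> F x = s x *\<^sub>R A x + z x *\<^sub>R B x"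
    and index_one: "\<And>p. p \<in> M \<Longrightarrow> F p = 0 \<Longrightarrow>
      \<exists>\<epsilon>>0. \<forall>r. 0 < r \<and> r < \<epsilon> \<longrightarrow> has_log (sphere p r) (\<lambda>x. F x / (x - p))"
  shows False
proof -
  interpret R: regular_level_curve \<psi> g b R by (rule R)
  interpret Q: regular_level_curve \<psi> g c Q by (rule Q)
  define U where "U = inside R"
  define I where "I = Q \<union> inside Q"
  have U: "open U" "simply_connected U" "bounded U"
    unfolding U_def using R.open_inside R.simply_connected_inside R.bounded_inside by simp_all
  have I_eq: "I = - outside Q"
    unfolding I_def by (rule union_with_inside)
  have "closed Q" "closed R"
    using Q.compact_L R.compact_L by (simp_all add: compact_imp_closed)
  then have "open (outside Q)" "open (outside R)"
    by (simp_all add: open_outside)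
  moreover have "R \<union> U = - outside R"
    unfolding U_def by (rule union_with_inside)
  ultimately have closed: "closed I" "closed (R \<union> U)"
    by (simp_all add: I_eq closed_Compl)
  have "closure (inside Q) \<subseteq> R \<union> U"
    using closed(2) nested by (intro closure_minimal) (auto simp: U_def)
  then have "Q \<subseteq> R \<union> U"
    using Q.subset_closure_inside by (rule subset_trans[rotated])
  then have QU: "Q \<subseteq> U"
    using disjoint by blast
  have IU: "I \<subseteq> U"
    using QU nested by (simp add: I_def U_def)
  have M': "M = outside Q \<inter> U" by (simp add: M U_def)
  have UM: "U = I \<union> M" and IM: "I \<inter> M = {}"
    using IU unfolding M' I_eq by blast+
  have "open M"
    unfolding M' using \<open>open (outside Q)\<close> U(1) by (rule open_Int)

  obtain q where q: "q \<in> inside Q" "has_log Q (\<lambda>x. g x / (x - q))"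
    by (rule Q.gradient_has_log)
  have "has_log Q (\<lambda>x. B x / (x - q))"
    by (rule has_log_cong[OF has_log_mult[OF B(3) q(2)]]) (use Q.gradient_nonzero in auto)
  then obtain h0 :: "complex \<Rightarrow> complex" where h0: "continuous_on Q h0"
    "\<And>x. x \<in> Q \<Longrightarrow> B x / (x - q) = exp (h0 x)"
    by (rule has_logE) blast
  obtain h :: "complex \<Rightarrow> complex" where h: "continuous_on UNIV h" "\<And>x. x \<in> Q \<Longrightarrow> h x = h0 x"
    using Tietze_unbounded[OF h0(1), of UNIV] Q.compact_L by (auto simp: compact_imp_closed)
  \<comment> \<open>the composite field, continued to the inside of \<open>Q\<close> with the single zero \<open>q\<close>\<close>
  define G where "G = (\<lambda>x. if x \<in> I then (x - q) * exp (h x) else s x *\<^sub>R A x + z x *\<^sub>R B x)"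
  have qQ: "q \<notin> Q" using q(1) inside_no_overlap[of Q] by blast
  have B_eq: "B x = (x - q) * exp (h x)" if "x \<in> Q" for x
  proof -
    have "x - q \<noteq> 0" using qQ that by auto
    then show ?thesis using h0(2)[OF that] h(2)[OF that] by (simp add: divide_eq_eq mult.commute)
  qed
  have GM: "G x = F x" if "x \<in> M" for x
    using that IM F[OF that] by (auto simp: G_def)
  have contG: "continuous_on U G"
  proof -
    have U_eq: "U = I \<union> (Q \<union> M)" using UM by (auto simp: I_def)
    have "continuous_on (I \<union> (Q \<union> M)) G"
      unfolding G_def
    proof (rule continuous_on_cases_local)
      show "closedin (top_of_set (I \<union> (Q \<union> M))) I"
        using closed by (intro closed_subset) auto
      have "Q \<union> M = (I \<union> (Q \<union> M)) \<inter> - inside Q"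
        using inside_no_overlap[of Q] inside_Int_outside[of Q] M unfolding I_def by blast
      then show "closedin (top_of_set (I \<union> (Q \<union> M))) (Q \<union> M)"
        using Q.open_inside by (metis closed_Compl closedin_closed_Int)
      show "continuous_on I (\<lambda>x. (x - q) * exp (h x))"
        by (intro continuous_intros continuous_on_subset[OF h(1)]) auto
      have "Q \<union> M \<subseteq> inside R" using QU M by (auto simp: U_def)
      then show "continuous_on (Q \<union> M) (\<lambda>x. s x *\<^sub>R A x + z x *\<^sub>R B x)"
        by (intro continuous_intros continuous_on_subset[OF A(1)] B(1)
            continuous_on_subset[OF s(1)] continuous_on_subset[OF z(1)]) auto
      show "(x - q) * exp (h x) = s x *\<^sub>R A x + z x *\<^sub>R B x"
        if "x \<in> I \<and> x \<notin> I \<or> x \<in> Q \<union> M \<and> x \<in> I" for x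
      proof -
        have "x \<in> Q" using that IM by auto
        then show ?thesis using s(3) z(3) B_eq by simp
      qed
    qed
    then show ?thesis using U_eq by simp
  qed

  \<comment> \<open>Off \<open>K\<close> the weight of \<open>A\<close> exceeds that of
    \<open>B\<close>. On \<open>R\<close> the weights are 1 and 0, so this compact set stays away
    from \<open>R\<close>.\<close>
  define K where "K = (R \<union> U) \<inter> {x. s x \<le> z x}"
  have "compact K"
    unfolding K_def
  proof (rule compact_Int_closed)
    show "compact (R \<union> U)"
      using closed(2) R.compact_L U(3) by (simp add: compact_eq_bounded_closed)
    show "closed {x. s x \<le> z x}"
      by (intro closed_Collect_le s(1) z(1))
  qed
  have KU: "K \<subseteq> U" using s(2) z(2) by (auto simp: K_def)
  have IK: "I \<subseteq> K" using IU s(3) z(3) by (auto simp: K_def I_def)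
  define E where "E = {x\<in>U. G x = 0}"
  have EK: "E \<subseteq> K"
  proof
    fix x assume x: "x \<in> E"
    show "x \<in> K"
    proof (cases "x \<in> I")
      case False
      then have xM: "x \<in> M" using x UM by (auto simp: E_def)
      \<comment> \<open>Two weighted unit vectors can cancel only if the weights agree, which puts
        the zero in \<open>K\<close>.\<close>
      with x have "s x *\<^sub>R A x = - (z x *\<^sub>R B x)"
        using GM F by (auto simp: E_def eq_neg_iff_add_eq_0)
      then have "norm (s x *\<^sub>R A x) = norm (z x *\<^sub>R B x)" by simp
      then show ?thesis
        using xM x A(2) B(2) s(4) z(4) by (auto simp: E_def U_def K_def)
    qed (use IK in auto)
  qed
  \<comment> \<open>This makes the set of zeros nonempty, without which the count would give no
    contradiction.\<close>
  have "q \<in> E" using q IU by (auto simp: E_def G_def I_def)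
  have index_E: "\<exists>\<epsilon>>0. \<forall>r. 0 < r \<and> r < \<epsilon> \<longrightarrow> has_log (sphere p r) (\<lambda>x. G x / (x - p))"
    if p: "p \<in> E" for p
  proof (cases "p \<in> I")
    case True
    then have "p = q" using p by (auto simp: E_def G_def)
    obtain \<epsilon> where \<epsilon>: "\<epsilon> > 0" "ball q \<epsilon> \<subseteq> inside Q"
      using q(1) Q.open_inside open_contains_ball by blast
    have "has_log (sphere q r) (\<lambda>x. G x / (x - q))" if "0 < r" "r < \<epsilon>" for r
    proof (rule has_logI)
      show "continuous_on (sphere q r) h" by (rule continuous_on_subset[OF h(1)]) auto
      fix x assume x: "x \<in> sphere q r"
      then have "x \<in> I" "x \<noteq> q" using that \<epsilon>(2) by (auto simp: I_def)
      then show "G x / (x - q) = exp (h x)" by (simp add: G_def)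
    qed
    then show ?thesis using \<epsilon>(1) \<open>p = q\<close> by blast
  next
    case False
    then have pM: "p \<in> M" "F p = 0" using p UM GM by (auto simp: E_def)
    obtain \<epsilon> where \<epsilon>: "\<epsilon> > 0" "\<And>r. 0 < r \<Longrightarrow> r < \<epsilon> \<Longrightarrow> has_log (sphere p r) (\<lambda>x. F x / (x - p))"
      using index_one[OF pM] by blast
    obtain d where d: "d > 0" "ball p d \<subseteq> M"
      using pM(1) \<open>open M\<close> open_contains_ball by blast
    have "has_log (sphere p r) (\<lambda>x. G x / (x - p))" if "0 < r" "r < min \<epsilon> d" for r
      by (rule has_log_cong[OF \<epsilon>(2)[of r]]) (use that d(2) GM in auto)
    then show ?thesis using \<epsilon>(1) d(1) by (intro exI[of _ "min \<epsilon> d"]) auto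
  qed
  \<comment> \<open>By continuity an accumulation point of zeros in \<open>K\<close> is itself a
    zero. The index condition then makes all small circles around it zero-free, so it is
    isolated.\<close>
  have "finite E"
  proof (rule ccontr)
    assume "infinite E"
    then obtain l where l: "l \<in> K" "l islimpt E"
      using \<open>compact K\<close> EK compact_eq_Bolzano_Weierstrass[of K] by blast
    then have "l \<in> U" using KU by blast
    have "isCont G l"
      using contG U(1) \<open>l \<in> U\<close> continuous_on_eq_continuous_at by blast
    have "G l = 0"
    proof (rule ccontr)
      assume "G l \<noteq> 0"
      then obtain d where d: "d > 0" "\<And>y. dist l y < d \<Longrightarrow> G y \<noteq> 0"
        using continuous_at_avoid[OF \<open>isCont G l\<close>] by blast
      then obtain x where "x \<in> E" "dist x l < d"
        using l(2) unfolding islimpt_approachable by blast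
      then show False using d(2)[of x] by (simp add: E_def dist_commute)
    qed
    then have "l \<in> E" using \<open>l \<in> U\<close> by (simp add: E_def)
    then obtain \<epsilon> where \<epsilon>: "\<epsilon> > 0" "\<And>r. 0 < r \<Longrightarrow> r < \<epsilon> \<Longrightarrow> has_log (sphere l r) (\<lambda>x. G x / (x - l))"
      using index_E by blast
    obtain x where x: "x \<in> E" "x \<noteq> l" "dist x l < \<epsilon>"
      using l(2) \<epsilon>(1) unfolding islimpt_approachable by blast
    have "G x / (x - l) \<noteq> 0"
      by (rule has_log_nonzero[OF \<epsilon>(2)[of "dist x l"]]) (use x in \<open>auto simp: dist_commute\<close>)
    with x show False by (simp add: E_def)
  qed
  have "has_log (U - K) G"
  proof -
    have UK: "U - K \<subseteq> M" using UM IK by blast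
    have nz: "A x \<noteq> 0" if "x \<in> U" for x using A(2) that by (force simp: U_def)
    \<comment> \<open>This is the field divided by \<open>A\<close>. As \<open>B / A\<close> has
      modulus one, its real part is at least \<open>s x - z x\<close>, which is positive off
      \<open>K\<close>.\<close>
    have "has_log (U - K) (\<lambda>x. of_real (s x) + of_real (z x) * (B x / A x))"
    proof (rule has_log_Re_pos)
      show "continuous_on (U - K) (\<lambda>x. of_real (s x) + of_real (z x) * (B x / A x))"
        using UK nz unfolding U_def
        by (intro continuous_intros continuous_on_subset[OF A(1)] continuous_on_subset[OF B(1)]
            continuous_on_subset[OF s(1)] continuous_on_subset[OF z(1)]) auto
      fix x assume x: "x \<in> U - K"
      then have xM: "x \<in> M" and sz: "z x < s x" using UK by (auto simp: K_def)
      have "norm (B x / A x) = 1" using x xM A(2) B(2) by (simp add: norm_divide U_def)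
      then have "Re (B x / A x) \<ge> - 1" using abs_Re_le_cmod[of "B x / A x"] by simp
      then have "z x * Re (B x / A x) \<ge> z x * (- 1)" by (rule mult_left_mono) (rule z(4)[OF xM])
      moreover have "Re (of_real (s x) + of_real (z x) * (B x / A x)) = s x + z x * Re (B x / A x)"
        by (simp only: plus_complex.sel times_complex.sel Re_complex_of_real Im_complex_of_real)
      ultimately show "Re (of_real (s x) + of_real (z x) * (B x / A x)) > 0" using sz by linarith
    qed
    moreover have "has_log U A"
      by (rule simply_connected_has_log[OF U(1,2)]) (use A nz in \<open>auto simp: U_def\<close>)
    then have "has_log (U - K) A" by (rule has_log_subset) auto
    ultimately have "has_log (U - K) (\<lambda>x. (of_real (s x) + of_real (z x) * (B x / A x)) * A x)"
      by (rule has_log_mult)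
    then show ?thesis
    proof (rule has_log_cong)
      fix x assume x: "x \<in> U - K"
      then have "x \<in> M" "A x \<noteq> 0" using UK nz by auto
      then have "G x = of_real (s x) * A x + of_real (z x) * B x"
        using GM F by (simp add: scaleR_conv_of_real)
      also have "\<dots> = (of_real (s x) + of_real (z x) * (B x / A x)) * A x"
        using \<open>A x \<noteq> 0\<close> by (simp add: distrib_right)
      finally show "G x = (of_real (s x) + of_real (z x) * (B x / A x)) * A x" .
    qed
  qed
  moreover have "\<not> has_log (U - K) G"
  proof (rule index_one_zeros_no_log_near_boundary[OF U \<open>compact K\<close> KU \<open>finite E\<close>])
    show "continuous_on (U - E) G" using contG by (rule continuous_on_subset) auto
  qed (use \<open>q \<in> E\<close> index_E in \<open>auto simp: E_def\<close>)
  ultimately show False by contradiction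
qed

section \<open>Transfer from the plane to the complex numbers\<close>

definition to_complex :: "plane \<Rightarrow> complex" where
  "to_complex v = Complex (v $ 1) (v $ 2)"

definition of_complex :: "complex \<Rightarrow> plane" where
  "of_complex w = vector [Re w, Im w]"

lemma to_complex_of_complex [simp]: "to_complex (of_complex w) = w"
  by (simp add: to_complex_def of_complex_def)

lemma of_complex_to_complex [simp]: "of_complex (to_complex v) = v"
  by (simp add: to_complex_def of_complex_def vec_eq_iff forall_2)

lemma linear_to_complex: "linear to_complex"
  by (rule linearI) (simp_all add: to_complex_def complex_eq_iff)

lemma linear_of_complex: "linear of_complex"
  by (rule linearI) (simp_all add: of_complex_def vec_eq_iff forall_2)

lemma inner_to_complex [simp]: "to_complex u \<bullet> to_complex v = u \<bullet> v"
  by (simp add: to_complex_def inner_vec_def sum_2 inner_complex_def)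

lemma norm_to_complex [simp]: "norm (to_complex v) = norm v"
  by (simp add: norm_eq_sqrt_inner)

lemma to_complex_sgn: "to_complex (sgn v) = sgn (to_complex v)"
  by (simp add: sgn_div_norm linear_scale[OF linear_to_complex])

lemma to_complex_eq_0_iff [simp]: "to_complex v = 0 \<longleftrightarrow> v = 0"
  by (metis norm_eq_zero norm_to_complex)

lemma continuous_on_to_complex [continuous_intros]:
  "continuous_on S f \<Longrightarrow> continuous_on S (\<lambda>x. to_complex (f x))"
  by (rule bounded_linear.continuous_on[OF linear_to_complex[unfolded linear_conv_bounded_linear]])

lemma continuous_on_of_complex [continuous_intros]:
  "continuous_on S f \<Longrightarrow> continuous_on S (\<lambda>x. of_complex (f x))"
  by (rule bounded_linear.continuous_on[OF linear_of_complex[unfolded linear_conv_bounded_linear]])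

lemma image_to_complex: "to_complex ` S = {w. of_complex w \<in> S}"
  by (force intro: image_eqI[of _ to_complex "of_complex _"])

lemma homeomorphism_to_complex: "homeomorphism S (to_complex ` S) to_complex of_complex"
  by (auto simp: homeomorphism_def image_image intro!: continuous_intros)

lemma bounded_to_complex_image [simp]: "bounded (to_complex ` S) \<longleftrightarrow> bounded S"
  by (simp add: bounded_iff)

lemma Compl_to_complex_image: "- to_complex ` S = to_complex ` (- S)"
  by (auto simp: image_to_complex)

text \<open>A norm-preserving homeomorphism of the whole plane matches the components of the two
  complements and their boundedness.\<close>

lemma inside_to_complex_image: "inside (to_complex ` S) = to_complex ` inside S"
proof -
  have "x \<in> inside S \<longleftrightarrow> to_complex x \<in> inside (to_complex ` S)" for x
  proof (cases "x \<in> S")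
    case False
    then have "connected_component_set (- to_complex ` S) (to_complex x)
        = to_complex ` connected_component_set (- S) x"
      unfolding Compl_to_complex_image
      by (intro connected_component_set_homeomorphism[OF homeomorphism_to_complex]) auto
    moreover have "to_complex x \<notin> to_complex ` S"
      using False by (simp add: image_to_complex)
    ultimately show ?thesis using False by (simp add: inside_def)
  qed (simp add: inside_def)
  then have "of_complex w \<in> inside S \<longleftrightarrow> w \<in> inside (to_complex ` S)" for w
    by (metis to_complex_of_complex)
  then show ?thesis
    unfolding image_to_complex[of "inside S"] by blast
qed

lemma outside_to_complex_image: "outside (to_complex ` S) = to_complex ` outside S"
  unfolding outside_inside inside_to_complex_image
  by (simp add: image_Un[symmetric] Compl_to_complex_image)

lemma closure_to_complex_image: "closure (to_complex ` S) = to_complex ` closure S"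
  by (rule closure_injective_linear_image[OF linear_to_complex, symmetric])
    (metis injI of_complex_to_complex)

section \<open>Gradients and guiding fields as complex functions\<close>

lemma grad_has_derivative:
  assumes "f differentiable (at x)"
  shows "(f has_derivative (\<lambda>h. grad f x \<bullet> h)) (at x)"
proof -
  let ?f' = "frechet_derivative f (at x)"
  have der: "(f has_derivative ?f') (at x)"
    using assms frechet_derivative_works by blast
  then have lin: "linear ?f'" by (rule has_derivative_linear)
  have "?f' h = grad f x \<bullet> h" for h
  proof -
    have "?f' h = ?f' (h $ 1 *\<^sub>R axis 1 1 + h $ 2 *\<^sub>R axis 2 1)"
      by (rule arg_cong[of _ _ ?f']) (simp add: vec_eq_iff forall_2 axis_def)
    also have "\<dots> = grad f x \<bullet> h"
      by (simp add: linear_add[OF lin] linear_scale[OF lin] grad_def inner_vec_def sum_2 mult.commute)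
    finally show ?thesis .
  qed
  then have "?f' = (\<lambda>h. grad f x \<bullet> h)" by (rule ext)
  with der show ?thesis by simp
qed

lemma Ck_Suc_imp_continuous_on: "Ck (Suc k) f \<Longrightarrow> continuous_on S f"
  by (auto intro!: continuous_at_imp_continuous_on differentiable_imp_continuous_within)

lemma Ck_2_continuous_on_grad:
  assumes "Ck 2 f"
  shows "continuous_on S (grad f)"
proof -
  have "Ck (Suc (Suc 0)) f" using assms by (simp add: numeral_2_eq_2)
  then have "\<forall>i. Ck (Suc 0) (\<lambda>x. grad f x $ i)" by simp
  then have "\<forall>i. continuous_on S (\<lambda>x. grad f x $ i)" using Ck_Suc_imp_continuous_on by blast
  then show ?thesis
    using continuous_on_vec_lambda[of S "\<lambda>i x. grad f x $ i"] by simp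
qed

lemma regular_level_curve_plane:
  assumes "Ck 2 f" "compact L" "connected L" "L \<noteq> {}" "L = {x. f x = c}"
    and "\<forall>x\<in>L. grad f x \<noteq> 0"
  shows "regular_level_curve (\<lambda>w. f (of_complex w)) (\<lambda>w. to_complex (grad f (of_complex w))) c
      (to_complex ` L)"
proof
  fix w
  have "Ck (Suc (Suc 0)) f" using assms(1) by (simp add: numeral_2_eq_2)
  then have "f differentiable (at (of_complex w))" by simp
  note der = grad_has_derivative[OF this]
  have "(of_complex has_derivative of_complex) (at w)"
    using linear_of_complex by (simp add: bounded_linear_imp_has_derivative linear_conv_bounded_linear)
  from has_derivative_compose[OF this der]
  have "((\<lambda>w. f (of_complex w)) has_derivative (\<lambda>h. grad f (of_complex w) \<bullet> of_complex h)) (at w)" .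
  moreover have "grad f (of_complex w) \<bullet> of_complex h = to_complex (grad f (of_complex w)) \<bullet> h" for h
    by (metis inner_to_complex to_complex_of_complex)
  ultimately show "((\<lambda>w. f (of_complex w)) has_derivative
      (\<lambda>h. to_complex (grad f (of_complex w)) \<bullet> h)) (at w)"
    by simp
next
  show "continuous_on UNIV (\<lambda>w. to_complex (grad f (of_complex w)))"
    by (intro continuous_intros continuous_on_compose2[OF Ck_2_continuous_on_grad[OF assms(1), of UNIV]])
      auto
  show "compact (to_complex ` L)" "connected (to_complex ` L)"
    using assms by (auto intro!: compact_continuous_image connected_continuous_image continuous_intros)
  show "to_complex ` L = {w. f (of_complex w) = c}"
    using assms(5) by (simp add: image_to_complex)
qed (use assms in auto)

text \<open>The matrix \<open>rot\<close> is multiplication by the imaginary unit, so the guiding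
  field is the gradient times a scalar with imaginary part 1. That scalar never vanishes.\<close>

lemma to_complex_guiding_field:
  "to_complex (guiding_field k f x) = (\<i> - of_real (k * f x)) * to_complex (grad f x)"
  by (simp add: guiding_field_def rot_def to_complex_def complex_eq_iff matrix_vector_mult_def sum_2
      algebra_simps)

lemma guiding_field_eq_0_iff: "guiding_field k f x = 0 \<longleftrightarrow> grad f x = 0"
proof -
  have "\<i> - of_real (k * f x) \<noteq> 0" by (simp add: complex_eq_iff)
  then show ?thesis
    by (metis mult_eq_0_iff to_complex_eq_0_iff to_complex_guiding_field)
qed

lemma continuous_on_guiding_field:
  assumes "Ck 2 f"
  shows "continuous_on S (guiding_field k f)"
proof -
  have f: "continuous_on S f"
    using assms Ck_Suc_imp_continuous_on[of 1 f] by (simp only: Suc_1)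
  have grad: "continuous_on S (grad f)"
    using assms by (rule Ck_2_continuous_on_grad)
  then have "continuous_on S (\<lambda>x. rot *v grad f x)"
    by (rule linear_continuous_on_compose) (rule matrix_vector_mul_linear)
  with f grad show ?thesis
    unfolding guiding_field_def by (intro continuous_intros)
qed

text \<open>The quotient is \<open>\<i> - k * f\<close> divided by a positive norm. Taking out the
  factor \<open>\<i>\<close> leaves \<open>u\<close>, whose real part is the reciprocal of that
  norm.\<close>

lemma guiding_field_direction_has_log:
  assumes "\<And>x. x \<in> S \<Longrightarrow> grad f x \<noteq> 0" "continuous_on S f" "continuous_on S (grad f)"
  shows "has_log (to_complex ` S) (\<lambda>w. to_complex (sgn (guiding_field k f (of_complex w))) /
           to_complex (grad f (of_complex w)))"
proof -
  define N where "N = (\<lambda>w. norm (guiding_field k f (of_complex w)))"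
  define u where "u = (\<lambda>w. 1 / of_real (N w) + \<i> * of_real (k * f (of_complex w) / N w))"
  have N: "N w > 0" if "w \<in> to_complex ` S" for w
    using that assms(1) by (auto simp: N_def guiding_field_eq_0_iff)
  have N_eq: "N w = norm ((\<i> - of_real (k * f (of_complex w))) * to_complex (grad f (of_complex w)))" for w
    unfolding N_def by (metis norm_to_complex to_complex_guiding_field)
  have contf: "continuous_on (to_complex ` S) (\<lambda>w. f (of_complex w))"
    and contg: "continuous_on (to_complex ` S) (\<lambda>w. grad f (of_complex w))"
    by (rule continuous_on_compose2[OF assms(2)] continuous_on_compose2[OF assms(3)];
        auto intro!: continuous_intros)+
  have "continuous_on (to_complex ` S) N"
    unfolding N_eq by (intro continuous_intros contf contg)
  then have "continuous_on (to_complex ` S) u"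
    unfolding u_def using N by (intro continuous_intros contf) fastforce+
  then have "has_log (to_complex ` S) u"
    by (rule has_log_Re_pos) (use N in \<open>simp add: u_def\<close>)
  from has_log_mult[OF has_log_const this, of \<i>]
  have "has_log (to_complex ` S) (\<lambda>w. \<i> * u w)" by simp
  then show ?thesis
  proof (rule has_log_cong)
    fix w assume w: "w \<in> to_complex ` S"
    have "to_complex (sgn (guiding_field k f (of_complex w))) =
        to_complex (guiding_field k f (of_complex w)) / of_real (N w)"
      by (simp add: to_complex_sgn sgn_eq N_def)
    moreover have "to_complex (grad f (of_complex w)) \<noteq> 0" using w assms(1) by auto
    moreover have "of_real (N w) \<noteq> (0::complex)" using N[OF w] by simp
    ultimately show "to_complex (sgn (guiding_field k f (of_complex w))) /
           to_complex (grad f (of_complex w)) = \<i> * u w"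
      by (simp add: to_complex_guiding_field u_def field_simps)
  qed
qed

lemma poincare_index_one_has_log:
  assumes "poincare_index D X p 1"
  shows "\<exists>\<epsilon>>0. \<forall>r. 0 < r \<and> r < \<epsilon> \<longrightarrow> has_log (sphere (to_complex p) r)
           (\<lambda>w. to_complex (X (of_complex w)) / (w - to_complex p))"
proof -
  obtain \<epsilon> where \<epsilon>: "\<epsilon> > 0" "continuous_on (ball p \<epsilon>) X" "\<forall>\<xi>\<in>ball p \<epsilon> - {p}. X \<xi> \<noteq> 0"
    and w: "\<And>r. 0 < r \<Longrightarrow> r < \<epsilon> \<Longrightarrow> winding_number
       (\<lambda>t. to_complex (X (p + r *\<^sub>R vector [cos (2 * pi * t), sin (2 * pi * t)]))) 0 = of_int 1"
    using assms unfolding poincare_index_def Let_def to_complex_def by blast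
  have "has_log (sphere (to_complex p) r) (\<lambda>w. to_complex (X (of_complex w)) / (w - to_complex p))"
    if r: "0 < r" "r < \<epsilon>" for r
  proof (rule winding_number_has_log_quotient[OF r(1)])
    have sub: "of_complex w \<in> ball p \<epsilon> - {p}" if "w \<in> sphere (to_complex p) r" for w
    proof -
      have "dist p (of_complex w) = dist (to_complex p) w"
        by (metis dist_norm linear_diff linear_to_complex norm_to_complex to_complex_of_complex)
      then show ?thesis using that r by auto
    qed
    show "continuous_on (sphere (to_complex p) r) (\<lambda>w. to_complex (X (of_complex w)))"
      using sub by (intro continuous_intros continuous_on_compose2[OF \<epsilon>(2)]) auto
    show "to_complex (X (of_complex w)) \<noteq> 0" if "w \<in> sphere (to_complex p) r" for w
      using \<epsilon>(3) sub[OF that] by simp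
    have "of_complex (to_complex p + of_real r * cis (2 * pi * t)) =
        p + r *\<^sub>R vector [cos (2 * pi * t), sin (2 * pi * t)]" for t
      by (simp add: of_complex_def to_complex_def vec_eq_iff forall_2)
    then show "winding_number (\<lambda>t. to_complex (X (of_complex
        (to_complex p + of_real r * cis (2 * pi * t))))) 0 = 1"
      using w[OF r] by simp
  qed
  with \<epsilon>(1) show ?thesis by blast
qed

section \<open>The saddle point\<close>

text \<open>The blending functions are prescribed on the closures of the regions; these inclusions
  give the prescribed values on the boundary curves themselves.\<close>

lemma level_curve_subset_closures:
  assumes "Ck 2 f" "compact L" "connected L" "L \<noteq> {}" "L = {x. f x = c}"
    and "\<forall>x\<in>L. grad f x \<noteq> 0"
  shows "L \<subseteq> closure (inside L)" "L \<subseteq> closure (outside L)"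
proof -
  interpret regular_level_curve "\<lambda>w. f (of_complex w)"
    "\<lambda>w. to_complex (grad f (of_complex w))" c "to_complex ` L"
    by (rule regular_level_curve_plane[OF assms])
  have "inj to_complex" by (metis injI of_complex_to_complex)
  then show "L \<subseteq> closure (inside L)" "L \<subseteq> closure (outside L)"
    using subset_closure_inside subset_closure_outside
    by (simp_all add: inside_to_complex_image outside_to_complex_image closure_to_complex_image
        inj_image_subset_iff)
qed

theorem lemma7:
  fixes \<phi> \<psi> S Z :: "plane \<Rightarrow> real"
    and c k\<^sub>p k\<^sub>r :: real
    and P Obs R Q R_in R_ex Q_in Q_ex M C\<^sub>P C\<^sub>R D :: "plane set"
    and X\<^sub>P X\<^sub>R X\<^sub>c :: "plane \<Rightarrow> plane"
  assumes phi_C2: "Ck 2 \<phi>"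
    and P_eq: "P = {\<xi>. \<phi> \<xi> = 0}"
    and P_connected: "connected P"
    and P_regular: "\<forall>\<xi>\<in>P. grad \<phi> \<xi> \<noteq> 0"
    and psi_C2: "Ck 2 \<psi>"
    and c_nonzero: "c \<noteq> 0"
    and R_eq: "R = {\<xi>. \<psi> \<xi> = 0}"
    and Q_eq: "Q = {\<xi>. \<psi> \<xi> = c}"
    and R_compact_connected: "compact R" "connected R"
    and Q_compact_connected: "compact Q" "connected Q"
    and R_regular: "\<forall>\<xi>\<in>R. grad \<psi> \<xi> \<noteq> 0"
    and Q_regular: "\<forall>\<xi>\<in>Q. grad \<psi> \<xi> \<noteq> 0"
    and R_sides: "R_in = inside R" "R_ex = outside R"
    and Q_sides: "Q_in = inside Q" "Q_ex = outside Q"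
    and Obs_bounded: "bounded Obs"
    and nesting: "Obs \<subseteq> Q_in" "Q_in \<subseteq> R_in"
    and Q_R_apart: "setdist Q R > 0"
    and P_not_inside: "\<not> P \<subseteq> closure R_in"
    and P_meets_inside: "R_in \<inter> P \<noteq> {}"
    and M_eq: "M = Q_ex \<inter> R_in"
    and gains: "k\<^sub>p > 0" "k\<^sub>r > 0"
    and X\<^sub>P_eq: "X\<^sub>P = guiding_field k\<^sub>p \<phi>"
    and X\<^sub>R_eq: "X\<^sub>R = guiding_field k\<^sub>r \<psi>"
    and C\<^sub>P_eq: "C\<^sub>P = {\<xi>. X\<^sub>P \<xi> = 0}"
    and C\<^sub>R_eq: "C\<^sub>R = {\<xi>. X\<^sub>R \<xi> = 0}"
    and standing_P: "positive_away_from (\<lambda>\<xi>. \<bar>\<phi> \<xi>\<bar>) P"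
                    "positive_away_from (\<lambda>\<xi>. norm (grad \<phi> \<xi>)) C\<^sub>P"
    and standing_R: "positive_away_from (\<lambda>\<xi>. \<bar>\<psi> \<xi>\<bar>) R"
                    "positive_away_from (\<lambda>\<xi>. norm (grad \<psi> \<xi>)) C\<^sub>R"
    and S_range: "\<forall>\<xi>\<in>M. 0 < S \<xi> \<and> S \<xi> < 1"
    and Z_range: "\<forall>\<xi>\<in>M. 0 < Z \<xi> \<and> Z \<xi> < 1"
    and S_smooth: "C_infinity (extend_blend (closure Q_in) (closure R_ex) 0 1 S)"
    and Z_smooth: "C_infinity (extend_blend (closure Q_in) (closure R_ex) 1 0 Z)"
    and D_eq: "D = - (C\<^sub>R \<union> C\<^sub>P)"
    and X\<^sub>c_eq: "X\<^sub>c = composite_field (closure Q_in) M S Z X\<^sub>P X\<^sub>R"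
    and equilibria_classified: "\<forall>\<xi>. equilibrium D X\<^sub>c \<xi> \<longrightarrow> classified_equilibrium D X\<^sub>c \<xi>"
    and defined_on_M: "M \<subseteq> D"
    and no_singular_P: "C\<^sub>P \<inter> R_in = {}"
  shows "\<exists>\<xi>\<in>M. hyperbolic_saddle D X\<^sub>c \<xi>"
proof (rule ccontr)
  assume no_saddle: "\<not> (\<exists>\<xi>\<in>M. hyperbolic_saddle D X\<^sub>c \<xi>)"
  \<comment> \<open>The value of \<open>setdist\<close> is 0 when one of the sets is empty, so the
    positive separation already excludes empty curves.\<close>
  have nonempty: "Q \<noteq> {}" "R \<noteq> {}"
    using Q_R_apart by auto
  have disjoint: "Q \<inter> R = {}"
    using c_nonzero by (auto simp: Q_eq R_eq)
  note R_curve = psi_C2 R_compact_connected nonempty(2) R_eq R_regular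
  note Q_curve = psi_C2 Q_compact_connected nonempty(1) Q_eq Q_regular
  have Q_closure: "Q \<union> Q_in \<subseteq> closure Q_in"
    using level_curve_subset_closures(1)[OF Q_curve] closure_subset[of Q_in] Q_sides by simp
  have R_closure: "R \<subseteq> closure R_ex"
    using level_curve_subset_closures(2)[OF R_curve] R_sides by simp
  have closure_Q: "closure Q_in \<subseteq> Q \<union> Q_in"
    unfolding Q_sides by (rule closure_inside_subset) (rule compact_imp_closed[OF Q_compact_connected(1)])
  have closure_R: "closure R_ex \<subseteq> R \<union> R_ex"
    unfolding R_sides by (rule closure_outside_subset) (rule compact_imp_closed[OF R_compact_connected(1)])
  \<comment> \<open>\<open>extend_blend\<close> tests the inner closed set first, so on
    \<open>R\<close> the outer value applies only once this is known.\<close>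
  have R_off: "R \<inter> closure Q_in = {}"
    using closure_Q disjoint nesting(2) inside_no_overlap[of R] R_sides by blast
  have M_off_Q: "M \<inter> closure Q_in = {}"
    using closure_Q inside_Int_outside[of Q] outside_no_overlap[of Q] unfolding M_eq Q_sides by blast
  have M_off_R: "M \<inter> closure R_ex = {}"
    using closure_R inside_Int_outside[of R] inside_no_overlap[of R] unfolding M_eq R_sides by blast
  have XP_nonzero: "X\<^sub>P x \<noteq> 0" if "x \<in> R_in" for x
    using no_singular_P that by (auto simp: C\<^sub>P_eq)
  have XR_nonzero: "X\<^sub>R x \<noteq> 0" if "x \<in> Q \<union> M" for x
    using that defined_on_M Q_regular by (auto simp: D_eq C\<^sub>R_eq X\<^sub>R_eq guiding_field_eq_0_iff)
  define s where "s = extend_blend (closure Q_in) (closure R_ex) 0 1 S"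
  define z where "z = extend_blend (closure Q_in) (closure R_ex) 1 0 Z"
  have "Ck (Suc 0) s" "Ck (Suc 0) z"
    using S_smooth Z_smooth unfolding C_infinity_def s_def z_def by blast+
  then have cont: "continuous_on UNIV s" "continuous_on UNIV z"
    by (blast intro: Ck_Suc_imp_continuous_on)+
  have cont_of_complex: "continuous_on T of_complex" for T
    by (intro continuous_intros)
  \<comment> \<open>With saddles excluded from \<open>M\<close>, the classification leaves only the
    alternatives of index one.\<close>
  have index_one: "poincare_index D X\<^sub>c p 1" if "p \<in> M" "X\<^sub>c p = 0" for p
  proof -
    have "equilibrium D X\<^sub>c p"
      using that defined_on_M by (auto simp: equilibrium_def)
    then have "classified_equilibrium D X\<^sub>c p"
      using equilibria_classified by simp
    then show ?thesis
      using no_saddle that(1) unfolding classified_equilibrium_def by simp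
  qed
  show False
  proof (rule blended_field_zeros_not_all_index_one[OF regular_level_curve_plane[OF R_curve]
        regular_level_curve_plane[OF Q_curve],
        of "to_complex ` M" "\<lambda>w. to_complex (sgn (X\<^sub>P (of_complex w)))"
        "\<lambda>w. to_complex (sgn (X\<^sub>R (of_complex w)))" "\<lambda>w. s (of_complex w)" "\<lambda>w. z (of_complex w)"
        "\<lambda>w. to_complex (X\<^sub>c (of_complex w))"])
    show "to_complex ` Q \<inter> to_complex ` R = {}"
      using disjoint by (auto simp: image_to_complex)
    show "inside (to_complex ` Q) \<subseteq> inside (to_complex ` R)"
      using nesting(2) by (auto simp: inside_to_complex_image R_sides Q_sides)
    show "to_complex ` M = outside (to_complex ` Q) \<inter> inside (to_complex ` R)"
      unfolding inside_to_complex_image outside_to_complex_image M_eq R_sides Q_sides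
      by (auto simp: image_to_complex)
    show "continuous_on (inside (to_complex ` R)) (\<lambda>w. to_complex (sgn (X\<^sub>P (of_complex w))))"
      unfolding X\<^sub>P_eq
      by (intro continuous_intros continuous_on_sgn ballI
          continuous_on_compose2[OF continuous_on_guiding_field[OF phi_C2, of UNIV] cont_of_complex])
        (use XP_nonzero in \<open>auto simp: X\<^sub>P_eq inside_to_complex_image R_sides\<close>)
    show "norm (to_complex (sgn (X\<^sub>P (of_complex w)))) = 1" if "w \<in> inside (to_complex ` R)" for w
      using that XP_nonzero by (auto simp: inside_to_complex_image R_sides norm_sgn)
    show "continuous_on (to_complex ` Q \<union> to_complex ` M) (\<lambda>w. to_complex (sgn (X\<^sub>R (of_complex w))))"
      unfolding X\<^sub>R_eq
      by (intro continuous_intros continuous_on_sgn ballI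
          continuous_on_compose2[OF continuous_on_guiding_field[OF psi_C2, of UNIV] cont_of_complex])
        (use XR_nonzero in \<open>auto simp: X\<^sub>R_eq\<close>)
    show "norm (to_complex (sgn (X\<^sub>R (of_complex w)))) = 1" if "w \<in> to_complex ` Q \<union> to_complex ` M" for w
      using that XR_nonzero by (auto simp: norm_sgn)
    have "continuous_on Q \<psi>"
      using psi_C2 Ck_Suc_imp_continuous_on[of 1 \<psi>] by (simp only: Suc_1)
    then show "has_log (to_complex ` Q) (\<lambda>w. to_complex (sgn (X\<^sub>R (of_complex w))) /
        to_complex (grad \<psi> (of_complex w)))"
      unfolding X\<^sub>R_eq using Q_regular
      by (intro guiding_field_direction_has_log Ck_2_continuous_on_grad[OF psi_C2]) auto
    show "continuous_on UNIV (\<lambda>w. s (of_complex w))" "continuous_on UNIV (\<lambda>w. z (of_complex w))"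
      by (rule continuous_on_compose2[OF cont(1) cont_of_complex]
          continuous_on_compose2[OF cont(2) cont_of_complex]; simp)+
    have on_R: "s x = 1 \<and> z x = 0" if "x \<in> R" for x
      using that R_off R_closure by (auto simp: s_def z_def extend_blend_def)
    then show "s (of_complex w) = 1" "z (of_complex w) = 0" if "w \<in> to_complex ` R" for w
      using that by auto
    have on_Q: "s x = 0 \<and> z x = 1" if "x \<in> Q \<union> Q_in" for x
      using that Q_closure by (auto simp: s_def z_def extend_blend_def)
    then show "s (of_complex w) = 0" "z (of_complex w) = 1"
      if "w \<in> to_complex ` Q \<union> inside (to_complex ` Q)" for w
      using that by (auto simp: inside_to_complex_image Q_sides)
    have on_M: "s x = S x \<and> z x = Z x" if "x \<in> M" for x
      using that M_off_Q M_off_R by (auto simp: s_def z_def extend_blend_def)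
    then show "s (of_complex w) \<ge> 0" "z (of_complex w) \<ge> 0" if "w \<in> to_complex ` M" for w
      using that S_range Z_range by (auto intro: less_imp_le)
    show "to_complex (X\<^sub>c (of_complex w)) = s (of_complex w) *\<^sub>R to_complex (sgn (X\<^sub>P (of_complex w))) +
        z (of_complex w) *\<^sub>R to_complex (sgn (X\<^sub>R (of_complex w)))" if "w \<in> to_complex ` M" for w
    proof -
      have x: "of_complex w \<in> M" using that by auto
      then have "of_complex w \<notin> closure Q_in" using M_off_Q by blast
      with x on_M[OF x] show ?thesis
        by (simp add: X\<^sub>c_eq composite_field_def linear_add[OF linear_to_complex]
            linear_scale[OF linear_to_complex])
    qed
    show "\<exists>\<epsilon>>0. \<forall>r. 0 < r \<and> r < \<epsilon> \<longrightarrow>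
        has_log (sphere w r) (\<lambda>x. to_complex (X\<^sub>c (of_complex x)) / (x - w))"
      if "w \<in> to_complex ` M" "to_complex (X\<^sub>c (of_complex w)) = 0" for w
    proof -
      have "of_complex w \<in> M" "X\<^sub>c (of_complex w) = 0" using that by auto
      from poincare_index_one_has_log[OF index_one[OF this]] show ?thesis by simp
    qed
  qed
qed

end
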